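(* Let $1\le s_1<s_2<\dots<s_k$ be fixed integers, $k\ge1$, and let $L(z)=2k-\sum_{i=1}^k(z^{s_i}+z^{-s_i})$. Then the thermodynamic limit of the sequence of circulant graphs $C_n(s_1,\dots,s_k)$ equals the small Mahler measure of $L$, that is, $$\lim_{n\to\infty}\frac{\log\tau(C_n(s_1,\dots,s_k))}{n}=m(L),\qquad m(L)=\int_0^1\log|L(e^{2\pi i t})|\,dt,$$ where $n$ runs over integers $n>2s_k$ for which $C_n(s_1,\dots,s_k)$ is connected, i.e. $\gcd(s_1,\dots,s_k,n)=1$.
   Context: $C_n(s_1,\dots,s_k)$ is the graph with vertices $0,1,\dots,n-1$ in which each vertex $i$ is adjacent to the vertices $i\pm s_1,\dots,i\pm s_k\pmod n$. $\tau(G)$ denotes the number of spanning trees of $G$. The thermodynamic limit of a sequence of graphs $G_n$ with $v(G_n)$ vertices is $\lim_{n\to\infty}\frac{\log\tau(G_n)}{v(G_n)}$. *)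

theory Defs
  imports "HOL-Analysis.Analysis" "HOL-Number_Theory.Cong"
begin

text \<open>Simple undirected graphs; an edge is a two-element set of vertices.\<close>

record 'a sgraph =
  vertices :: "'a set"
  edges :: "'a set set"

definition connected_graph :: "'a sgraph \<Rightarrow> bool" where
  "connected_graph G \<longleftrightarrow> vertices G \<noteq> {} \<and>
     (\<forall>u\<in>vertices G. \<forall>v\<in>vertices G. (u, v) \<in> {(x, y). {x, y} \<in> edges G}\<^sup>*)"

text \<open>A cycle is given by its list of pairwise distinct vertices, in cyclic order.\<close>

definition is_cycle :: "'a sgraph \<Rightarrow> 'a list \<Rightarrow> bool" where
  "is_cycle G p \<longleftrightarrow> length p \<ge> 3 \<and> distinct p \<and>
     (\<forall>i<length p. {p ! i, p ! (Suc i mod length p)} \<in> edges G)"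

definition tree :: "'a sgraph \<Rightarrow> bool" where
  "tree G \<longleftrightarrow> connected_graph G \<and> (\<nexists>p. is_cycle G p)"

definition spanning_tree :: "'a sgraph \<Rightarrow> 'a sgraph \<Rightarrow> bool" where
  "spanning_tree T G \<longleftrightarrow> vertices T = vertices G \<and> edges T \<subseteq> edges G \<and> tree T"

definition num_spanning_trees :: "'a sgraph \<Rightarrow> nat" where
  "num_spanning_trees G = card {T. spanning_tree T G}"

text \<open>
  The circulant graph \<open>C\<^sub>n(S)\<close>. It is a simple graph whenever \<open>n > 2 * s > 0\<close> for all jumps
  \<open>s \<in> S\<close>; for smaller \<open>n\<close> this encoding would lose edge multiplicities.
\<close>

definition circulant :: "nat \<Rightarrow> nat set \<Rightarrow> nat sgraph" where
  "circulant n S = \<lparr> vertices = {..<n},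
     edges = {{i, j} | i j. i < n \<and> j < n \<and>
       (\<exists>s\<in>S. [int j = int i + int s] (mod int n) \<or> [int j = int i - int s] (mod int n))} \<rparr>"

text \<open>
  The filter \<open>F\<close> says along which indices \<open>n\<close> the limit is taken.
\<close>

definition has_thermodynamic_limit :: "(nat \<Rightarrow> 'a sgraph) \<Rightarrow> nat filter \<Rightarrow> real \<Rightarrow> bool" where
  "has_thermodynamic_limit G F l \<longleftrightarrow>
     ((\<lambda>n. ln (real (num_spanning_trees (G n))) / real (card (vertices (G n)))) \<longlongrightarrow> l) F"

definition small_mahler_measure :: "(complex \<Rightarrow> complex) \<Rightarrow> real" where
  "small_mahler_measure P =
     (LBINT t:{0..1}. ln (cmod (P (exp (2 * complex_of_real pi * \<i> * complex_of_real t)))))"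

definition circulant_laurent :: "nat \<Rightarrow> (nat \<Rightarrow> nat) \<Rightarrow> complex \<Rightarrow> complex" where
  "circulant_laurent k s z =
     2 * of_nat k - (\<Sum>i=1..k. z powi int (s i) + z powi (- int (s i)))"

end

theory Submission
  imports Defs "Jordan_Normal_Form.Determinant"
begin

text \<open>
  On the unit circle the Laurent polynomial is real and nonnegative,
  \<open>L(e\<^sup>2\<^sup>\<pi>\<^sup>i\<^sup>t) = \<Sum> 4 sin\<^sup>2(\<pi> a t)\<close> with \<open>a\<close> ranging over the jumps (\<open>sine_symbol\<close>), and its values at
  \<open>t = m/n\<close> are the Laplacian eigenvalues of the circulant graph. The number \<open>\<tau>\<close> of spanning trees
  is therefore governed by a Riemann sum of \<open>ln L\<close>, and the claim is that this Riemann sum converges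
  in spite of the logarithmic singularities of \<open>ln L\<close>.

  The link between \<open>\<tau>\<close> and the eigenvalues is a matrix-tree theorem. Row \<open>i\<close> of \<open>x I + Laplacian\<close> is a sum
  of \<open>x e\<^sub>i\<close> and of \<open>e\<^sub>i - e\<^sub>j\<close> over the neighbours \<open>j\<close>. Multilinearity of the determinant selects one
  summand per row, that is, a parent for each vertex, where \<open>x e\<^sub>i\<close> means that \<open>i\<close> is a root. The
  resulting determinant is 1 if the parent function has no directed cycle and 0 otherwise. So
  \<open>det (x I + Laplacian)\<close> is the generating function of rooted forests by number of roots
  (\<open>det_shifted_laplacian\<close>); its linear coefficient counts trees with a marked root
  and equals \<open>n \<tau>\<close> (\<open>card_single_rooted_forests\<close>). For a circulant graph the Fourier matrix
  diagonalises the Laplacian, and comparing linear coefficients gives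
  \<open>n \<tau> = \<Prod> L(e\<^sup>2\<^sup>\<pi>\<^sup>i\<^sup>m\<^sup>/\<^sup>n)\<close> over \<open>0 < m < n\<close> (\<open>circulant_spanning_tree_formula\<close>).

  For the limit let \<open>d\<close> be the gcd of the jumps. Writing \<open>d\<close> as an integer combination of the jumps gives
  \<open>L \<ge> c sin\<^sup>2(\<pi> d t)\<close> with some \<open>c > 0\<close>. If \<open>d\<close> and \<open>n\<close> are coprime, then \<open>|sin(\<pi> d m/n)| \<ge> 2/n\<close> for \<open>0 < m < n\<close>:
  no sample point comes closer to a singularity than the mesh width, up to a constant. Hence the value of
  \<open>|ln L|\<close> at a sample point is bounded by \<open>B - 2 ln |sin(\<pi> d t)|\<close> for all \<open>t\<close> in the
  mesh cell to the right of it (\<open>ln_sine_symbol_sample_bound\<close>). This bound is integrable and does not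
  depend on \<open>n\<close>, so dominated convergence applies to the step functions whose integrals are the
  Riemann sums (\<open>riemann_sum_ln_sine_symbol\<close>).
\<close>

hide_const (open) Determinants.det Finite_Cartesian_Product.mat
unbundle no vec_syntax

section \<open>Determinants as sums over rooted forests\<close>

text \<open>
  A map \<open>f\<close> sends each vertex \<open>i < n\<close> to its parent, where the value \<open>n\<close> stands for a virtual vertex above
  all roots. Such a map describes a rooted forest iff it has no directed cycle, which the height function \<open>d\<close>
  expresses without mentioning cycles.
\<close>

definition parent_forest :: "nat \<Rightarrow> (nat \<Rightarrow> nat) \<Rightarrow> bool" where
  "parent_forest n f \<longleftrightarrow> (\<exists>d :: nat \<Rightarrow> nat. \<forall>i<n. d (f i) < d i)"

text \<open>
  Multilinearity in the rows: the function \<open>f\<close> records which summand each row contributes.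
\<close>

lemma det_expand_rows:
  fixes w :: "nat \<Rightarrow> 'b \<Rightarrow> 'a::comm_ring_1"
  assumes "finite S"
  shows "det (mat n n (\<lambda>(i, j). \<Sum>l\<in>S. w i l * c i l j)) =
    (\<Sum>f\<in>{..<n} \<rightarrow>\<^sub>E S. (\<Prod>i<n. w i (f i)) * det (mat n n (\<lambda>(i, j). c i (f i) j)))"
proof -
  let ?P = "{p. p permutes {0..<n}}"
  have "det (mat n n (\<lambda>(i, j). \<Sum>l\<in>S. w i l * c i l j)) =
      (\<Sum>p\<in>?P. signof p * (\<Prod>i<n. \<Sum>l\<in>S. w i l * c i l (p i)))"
    unfolding det_def
    by (auto simp: atLeast0LessThan permutes_in_image intro!: sum.cong prod.cong)
  also have "\<dots> = (\<Sum>p\<in>?P. \<Sum>f\<in>{..<n} \<rightarrow>\<^sub>E S.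
      (\<Prod>i<n. w i (f i)) * (signof p * (\<Prod>i<n. c i (f i) (p i))))"
    using assms by (simp add: prod_sum_PiE sum_distrib_left prod.distrib mult_ac)
  also have "\<dots> = (\<Sum>f\<in>{..<n} \<rightarrow>\<^sub>E S. (\<Prod>i<n. w i (f i)) *
      (\<Sum>p\<in>?P. signof p * (\<Prod>i<n. c i (f i) (p i))))"
    by (subst sum.swap) (simp add: sum_distrib_left)
  also have "\<dots> = (\<Sum>f\<in>{..<n} \<rightarrow>\<^sub>E S. (\<Prod>i<n. w i (f i)) *
      det (mat n n (\<lambda>(i, j). c i (f i) j)))"
    unfolding det_def
    by (auto simp: atLeast0LessThan permutes_in_image intro!: sum.cong prod.cong arg_cong2[where f="(*)"])
  finally show ?thesis .
qed

text \<open>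
  In the Leibniz expansion a nonzero term belongs to a permutation that sends each vertex to itself or
  to its parent. Such a permutation lowers the height of every vertex that it moves but preserves the total
  height, so only the identity is left.
\<close>

lemma det_parent_forest:
  assumes "parent_forest n f"
  shows "det (mat n n (\<lambda>(i, j). of_bool (i = j) - of_bool (j = f i)) :: 'a::comm_ring_1 mat) = 1"
proof -
  obtain d :: "nat \<Rightarrow> nat" where d: "\<And>i. i < n \<Longrightarrow> d (f i) < d i"
    using assms unfolding parent_forest_def by blast
  let ?A = "mat n n (\<lambda>(i, j). of_bool (i = j) - of_bool (j = f i)) :: 'a mat"
  have zero: "(\<Prod>i = 0..<n. ?A $$ (i, p i)) = 0" if p: "p permutes {0..<n}" and "p \<noteq> id" for p
  proof (rule ccontr)
    assume nz: "(\<Prod>i = 0..<n. ?A $$ (i, p i)) \<noteq> 0"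
    have step: "p i = i \<or> p i = f i" if "i < n" for i
    proof (rule ccontr)
      assume "\<not> ?thesis"
      then have "?A $$ (i, p i) = 0"
        using that permutes_in_image[OF p, of i] by auto
      then have "\<exists>i\<in>{0..<n}. ?A $$ (i, p i) = 0"
        using that by (intro bexI[of _ i]) auto
      then have "(\<Prod>i = 0..<n. ?A $$ (i, p i)) = 0"
        by (intro prod_zero) simp_all
      then show False using nz by contradiction
    qed
    obtain i where i: "p i \<noteq> i" using \<open>p \<noteq> id\<close> by (auto simp: fun_eq_iff)
    then have "i < n" using p by (meson atLeastLessThan_iff le0 permutes_not_in)
    have "(\<Sum>i = 0..<n. d (p i)) < (\<Sum>i = 0..<n. d i)"
    proof (rule sum_strict_mono_ex1)
      show "\<forall>i\<in>{0..<n}. d (p i) \<le> d i"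
      proof
        fix i assume "i \<in> {0..<n}"
        then show "d (p i) \<le> d i" using step[of i] d[of i] by auto
      qed
      show "\<exists>i\<in>{0..<n}. d (p i) < d i"
        using step[OF \<open>i < n\<close>] i d[OF \<open>i < n\<close>] \<open>i < n\<close> by (intro bexI[of _ i]) auto
    qed simp
    moreover have "(\<Sum>i = 0..<n. d (p i)) = (\<Sum>i = 0..<n. d i)"
      using sum.permute[OF p, of d] by (simp add: o_def)
    ultimately show False by simp
  qed
  have "det ?A = (\<Sum>p\<in>{p. p permutes {0..<n}}. signof p * (\<Prod>i = 0..<n. ?A $$ (i, p i)))"
    unfolding det_def by simp
  also have "\<dots> = (\<Sum>p\<in>{id}. signof p * (\<Prod>i = 0..<n. ?A $$ (i, p i)))"
  proof (rule sum.mono_neutral_right)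
    show "\<forall>p\<in>{p. p permutes {0..<n}} - {id}. signof p * (\<Prod>i = 0..<n. ?A $$ (i, p i)) = 0"
      by (intro ballI, subst zero) auto
  qed (auto simp: finite_permutations permutes_id)
  also have "\<dots> = 1"
  proof -
    have "i \<noteq> f i" if "i < n" for i using d[OF that] by auto
    then show ?thesis by (auto intro!: prod.neutral)
  qed
  finally show ?thesis .
qed

text \<open>
  The set of vertices from which the virtual vertex \<open>n\<close> is never reached is nonempty and is closed under
  \<open>f\<close> and under taking preimages, so its indicator vector lies in the kernel.
\<close>

lemma det_not_parent_forest:
  assumes f: "\<And>i. i < n \<Longrightarrow> f i \<le> n" and "\<not> parent_forest n f"
  shows "det (mat n n (\<lambda>(i, j). of_bool (i = j) - of_bool (j = f i)) :: 'a::idom mat) = 0"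
proof -
  let ?A = "mat n n (\<lambda>(i, j). of_bool (i = j) - of_bool (j = f i)) :: 'a mat"
  define C where "C = {i. i < n \<and> (\<forall>m. (f ^^ m) i \<noteq> n)}"
  have "C \<noteq> {}"
  proof
    assume "C = {}"
    define d where "d = (\<lambda>i. LEAST m. (f ^^ m) i = n)"
    have "d (f i) < d i" if "i < n" for i
    proof -
      have "\<exists>m. (f ^^ m) i = n" using \<open>C = {}\<close> that unfolding C_def by blast
      then have m: "(f ^^ d i) i = n" unfolding d_def by (rule LeastI_ex)
      then have "d i \<noteq> 0" using that by (intro notI) simp
      then obtain m' where m': "d i = Suc m'" by (cases "d i") auto
      then have "(f ^^ m') (f i) = n" using m by (simp add: funpow_swap1)
      then have "d (f i) \<le> m'" unfolding d_def by (rule Least_le)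
      then show ?thesis using m' by simp
    qed
    then show False using assms(2) unfolding parent_forest_def by blast
  qed
  then obtain c where c: "c \<in> C" by blast
  define v :: "'a vec" where "v = vec n (\<lambda>i. of_bool (i \<in> C))"
  have C_less: "i < n" if "i \<in> C" for i using that by (simp add: C_def)
  have closed: "f i < n \<and> f i \<in> C" if "i \<in> C" for i
  proof -
    have i: "i < n" "\<And>m. (f ^^ m) i \<noteq> n" using that by (auto simp: C_def)
    have "(f ^^ m) (f i) \<noteq> n" for m using i(2)[of "Suc m"] by (simp add: funpow_swap1)
    moreover have "f i \<noteq> n" using i(2)[of 1] by simp
    ultimately show ?thesis using f[OF i(1)] by (auto simp: C_def)
  qed
  have open': "i \<in> C" if i: "i < n" "f i \<in> C" for i
  proof (rule ccontr)
    assume "i \<notin> C"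
    then obtain m where m: "(f ^^ m) i = n" using i by (auto simp: C_def)
    then obtain m' where "m = Suc m'" using i(1) by (cases m) auto
    then have "(f ^^ m') (f i) = n" using m by (simp add: funpow_swap1)
    then show False using i(2) by (auto simp: C_def)
  qed
  have "?A *\<^sub>v v = 0\<^sub>v n"
  proof (rule eq_vecI)
    fix i assume "i < dim_vec (0\<^sub>v n :: 'a vec)"
    then have i: "i < n" by simp
    have "(?A *\<^sub>v v) $ i = (\<Sum>j\<in>{0..<n}. (of_bool (i = j) - of_bool (j = f i)) * of_bool (j \<in> C))"
      using i by (simp add: scalar_prod_def v_def)
    also have "\<dots> = (\<Sum>j\<in>{0..<n}. if j = i then of_bool (i \<in> C) else 0) -
        (\<Sum>j\<in>{0..<n}. if j = f i then of_bool (f i \<in> C) else 0)"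
      unfolding sum_subtractf[symmetric] by (intro sum.cong) (auto simp: left_diff_distrib)
    also have "\<dots> = 0"
      using i closed[of i] open'[of i] C_less[of "f i"] by auto
    finally show "(?A *\<^sub>v v) $ i = 0\<^sub>v n $ i" using i by simp
  qed simp
  moreover have "v \<noteq> 0\<^sub>v n"
  proof
    assume "v = 0\<^sub>v n"
    then have "v $ c = 0" using c C_less[of c] by simp
    then show False using c C_less[of c] by (simp add: v_def)
  qed
  moreover have "v \<in> carrier_vec n" by (simp add: v_def)
  ultimately have "\<exists>v. v \<in> carrier_vec n \<and> v \<noteq> 0\<^sub>v n \<and> ?A *\<^sub>v v = 0\<^sub>v n" by blast
  then show ?thesis
    by (rule iffD2[OF det_0_iff_vec_prod_zero, rotated]) simp
qed

text \<open>
  The directed, weighted matrix-tree theorem: \<open>w i l\<close> is the weight of choosing \<open>l\<close> as the parent of \<open>i\<close>,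
  and \<open>w i n\<close> that of making \<open>i\<close> a root. The diagonal terms \<open>w i i\<close> cancel on the left; on the right they
  do not occur since a vertex of a forest is not its own parent.
\<close>

theorem det_laplacian_forests:
  fixes w :: "nat \<Rightarrow> nat \<Rightarrow> 'a::idom"
  shows "det (mat n n (\<lambda>(i, j). (if i = j then \<Sum>l\<le>n. w i l else 0) - w i j)) =
    (\<Sum>f | f \<in> {..<n} \<rightarrow>\<^sub>E {..n} \<and> parent_forest n f. \<Prod>i<n. w i (f i))"
proof -
  have "mat n n (\<lambda>(i, j). (if i = j then \<Sum>l\<le>n. w i l else 0) - w i j) =
      mat n n (\<lambda>(i, j). \<Sum>l\<le>n. w i l * (of_bool (i = j) - of_bool (j = l)))"
  proof (rule eq_matI, goal_cases)
    case (1 i j)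
    have "(\<Sum>l\<le>n. w i l * of_bool (j = l)) = (\<Sum>l\<le>n. if l = j then w i j else 0)"
      by (intro sum.cong) auto
    with 1 show ?case
      by (simp add: right_diff_distrib sum_subtractf sum_distrib_right[symmetric])
  qed simp_all
  then have "det (mat n n (\<lambda>(i, j). (if i = j then \<Sum>l\<le>n. w i l else 0) - w i j)) =
      (\<Sum>f\<in>{..<n} \<rightarrow>\<^sub>E {..n}. (\<Prod>i<n. w i (f i)) *
        det (mat n n (\<lambda>(i, j). of_bool (i = j) - of_bool (j = f i))))"
    by (simp add: det_expand_rows)
  also have "\<dots> = (\<Sum>f\<in>{..<n} \<rightarrow>\<^sub>E {..n}. if parent_forest n f then \<Prod>i<n. w i (f i) else 0)"
  proof (intro sum.cong refl)
    fix f assume "f \<in> {..<n} \<rightarrow>\<^sub>E {..n}"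
    then have "\<And>i. i < n \<Longrightarrow> f i \<le> n" by (auto simp: PiE_iff)
    then have "det (mat n n (\<lambda>(i, j). of_bool (i = j) - of_bool (j = f i))) =
        (of_bool (parent_forest n f) :: 'a)"
      using det_parent_forest[of n f] det_not_parent_forest[of n f]
      by (cases "parent_forest n f") auto
    then show "(\<Prod>i<n. w i (f i)) *
          det (mat n n (\<lambda>(i, j). of_bool (i = j) - of_bool (j = f i))) =
        (if parent_forest n f then \<Prod>i<n. w i (f i) else 0)"
      by simp
  qed
  also have "\<dots> = (\<Sum>f | f \<in> {..<n} \<rightarrow>\<^sub>E {..n} \<and> parent_forest n f. \<Prod>i<n. w i (f i))"
    by (subst sum.inter_filter[symmetric]) (auto intro: finite_PiE)
  finally show ?thesis .
qed

section \<open>Rooted forests and spanning trees\<close>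

abbreviation adj_rel :: "'a set set \<Rightarrow> ('a \<times> 'a) set" where
  "adj_rel E \<equiv> {(x, y). {x, y} \<in> E}"

text \<open>
  Loop erasure: a walk that returns to its first vertex is cut at the return.
\<close>

lemma distinct_path:
  assumes "(a, b) \<in> (adj_rel E)\<^sup>*"
  obtains p where "p \<noteq> []" "hd p = a" "last p = b" "distinct p"
    "successively (\<lambda>x y. {x, y} \<in> E) p"
proof -
  have "\<exists>p. p \<noteq> [] \<and> hd p = a \<and> last p = b \<and> distinct p \<and>
      successively (\<lambda>x y. {x, y} \<in> E) p"
    using assms
  proof (induction rule: converse_rtrancl_induct)
    case base
    show ?case by (intro exI[of _ "[b]"]) simp
  next
    case (step a c)
    then obtain p where p: "p \<noteq> []" "hd p = c" "last p = b" "distinct p"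
      "successively (\<lambda>x y. {x, y} \<in> E) p" by blast
    show ?case
    proof (cases "a \<in> set p")
      case True
      then obtain xs ys where "p = xs @ a # ys" by (meson split_list)
      with p show ?thesis
        by (intro exI[of _ "a # ys"]) (auto simp: successively_append_iff)
    next
      case False
      with p step(1) show ?thesis
        by (intro exI[of _ "a # p"]) (auto simp: successively_Cons)
    qed
  qed
  then show ?thesis using that by blast
qed

text \<open>
  An edge \<open>{a, b}\<close> outside the subgraph would close a simple path of the subgraph from \<open>a\<close> to \<open>b\<close> to a
  cycle; the path has at least three vertices because it does not use that edge.
\<close>

lemma connected_subgraph_of_acyclic:
  assumes "F \<subseteq> E" and loopless: "\<And>x. {x} \<notin> E"
    and "\<nexists>p. is_cycle \<lparr>vertices = V, edges = E\<rparr> p"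
    and conn: "\<And>x y. {x, y} \<in> E \<Longrightarrow> (x, y) \<in> (adj_rel F)\<^sup>*"
    and pairs: "\<And>e. e \<in> E \<Longrightarrow> \<exists>x y. e = {x, y}"
  shows "F = E"
proof (rule ccontr)
  assume "F \<noteq> E"
  then obtain a b where ab: "{a, b} \<in> E" "{a, b} \<notin> F"
    using assms(1) pairs by blast
  obtain p where p: "p \<noteq> []" "hd p = a" "last p = b" "distinct p"
    "successively (\<lambda>x y. {x, y} \<in> F) p"
    using distinct_path[OF conn[OF ab(1)]] by blast
  have "length p \<ge> 3"
  proof (rule ccontr)
    assume "\<not> length p \<ge> 3"
    moreover have "length p > 0" using p(1) by simp
    ultimately have "length p = 1 \<or> length p = 2" by linarith
    then show False
    proof
      assume "length p = 1"
      then have "a = b" using p by (cases p) auto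
      then show False using ab(1) loopless[of a] by simp
    next
      assume "length p = 2"
      then obtain x y where "p = [x, y]" by (auto simp: numeral_2_eq_2 length_Suc_conv)
      then show False using p ab(2) by auto
    qed
  qed
  moreover have "{p ! i, p ! (Suc i mod length p)} \<in> E" if i: "i < length p" for i
  proof (cases "Suc i < length p")
    case True
    have "{p ! i, p ! Suc i} \<in> F" using p(5) True by (simp add: successively_conv_nth)
    then show ?thesis using True assms(1) by auto
  next
    case False
    then have len: "length p = Suc i" using i by simp
    have "p ! i = b" using last_conv_nth[OF p(1)] p(3) len by simp
    moreover have "p ! (Suc i mod length p) = a"
      using hd_conv_nth[OF p(1)] p(2) len by simp
    ultimately have "{p ! i, p ! (Suc i mod length p)} = {b, a}" by simp
    then show ?thesis using ab(1) by (simp add: insert_commute)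
  qed
  ultimately have "is_cycle \<lparr>vertices = V, edges = E\<rparr> p"
    using p(4) by (simp add: is_cycle_def)
  then show False using assms(3) by blast
qed

definition forest_roots :: "nat \<Rightarrow> (nat \<Rightarrow> nat) \<Rightarrow> nat set" where
  "forest_roots n f = {i. i < n \<and> f i = n}"

definition forest_edges :: "nat \<Rightarrow> (nat \<Rightarrow> nat) \<Rightarrow> nat set set" where
  "forest_edges n f = {{i, f i} | i. i < n \<and> f i \<noteq> n}"

definition forests_in :: "nat \<Rightarrow> nat set set \<Rightarrow> (nat \<Rightarrow> nat) set" where
  "forests_in n E = {f \<in> {..<n} \<rightarrow>\<^sub>E {..n}. parent_forest n f \<and> forest_edges n f \<subseteq> E}"

lemma forest_connected_to_root:
  assumes "f \<in> {..<n} \<rightarrow>\<^sub>E {..n}" "parent_forest n f" "forest_roots n f = {r}" "v < n"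
  shows "(v, r) \<in> (adj_rel (forest_edges n f))\<^sup>*"
proof -
  obtain d :: "nat \<Rightarrow> nat" where d: "\<And>i. i < n \<Longrightarrow> d (f i) < d i"
    using assms unfolding parent_forest_def by blast
  show ?thesis
    using assms(4)
  proof (induction v rule: measure_induct_rule[of d])
    case (less v)
    show ?case
    proof (cases "f v = n")
      case True
      then have "v = r" using less.prems assms(3) by (auto simp: forest_roots_def)
      then show ?thesis by simp
    next
      case False
      moreover have "f v \<le> n" using assms(1) less.prems by (auto simp: PiE_iff)
      ultimately have "f v < n" by simp
      then have "(f v, r) \<in> (adj_rel (forest_edges n f))\<^sup>*"
        using less.IH d less.prems by blast
      moreover have "(v, f v) \<in> adj_rel (forest_edges n f)"
        using False less.prems by (auto simp: forest_edges_def)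
      ultimately show ?thesis by (rule converse_rtrancl_into_rtrancl[rotated])
    qed
  qed
qed

text \<open>
  Both neighbours on a cycle of a vertex of maximal height would be its parent.
\<close>

lemma forest_no_cycle:
  assumes "parent_forest n f"
  shows "\<not> is_cycle \<lparr>vertices = V, edges = forest_edges n f\<rparr> p"
proof
  assume "is_cycle \<lparr>vertices = V, edges = forest_edges n f\<rparr> p"
  then have p: "length p \<ge> 3" "distinct p"
    and e: "\<And>i. i < length p \<Longrightarrow> {p ! i, p ! (Suc i mod length p)} \<in> forest_edges n f"
    by (auto simp: is_cycle_def)
  obtain d :: "nat \<Rightarrow> nat" where d: "\<And>i. i < n \<Longrightarrow> d (f i) < d i"
    using assms unfolding parent_forest_def by blast
  let ?l = "length p"
  have "Max ((\<lambda>i. d (p ! i)) ` {..<?l}) \<in> (\<lambda>i. d (p ! i)) ` {..<?l}"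
    using p(1) by (intro Max_in) (auto simp: lessThan_empty_iff)
  then obtain i where i: "i < ?l" "d (p ! i) = Max ((\<lambda>i. d (p ! i)) ` {..<?l})" by auto
  have max: "d (p ! j) \<le> d (p ! i)" if "j < ?l" for j
    using that i by (auto intro!: Max_ge)
  have nb: "u = f (p ! i)" if "{p ! i, u} \<in> forest_edges n f" "d u \<le> d (p ! i)" for u
  proof -
    from that(1) obtain v where v: "v < n" "{p ! i, u} = {v, f v}"
      by (auto simp: forest_edges_def)
    then consider "p ! i = v" "u = f v" | "p ! i = f v" "u = v" by (auto simp: doubleton_eq_iff)
    then show ?thesis
    proof cases
      case 2
      then show ?thesis using d[OF v(1)] that(2) by simp
    qed simp
  qed
  define j where "j = Suc i mod ?l"
  define h where "h = (if i = 0 then ?l - 1 else i - 1)"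
  have "j < ?l" "h < ?l" "j \<noteq> h"
    using i(1) p(1) by (auto simp: j_def h_def mod_Suc split: if_splits)
  have "Suc h mod ?l = i" using i(1) p(1) by (auto simp: h_def)
  then have "{p ! i, p ! h} \<in> forest_edges n f" using e[OF \<open>h < ?l\<close>] by (simp add: insert_commute)
  then have "p ! h = f (p ! i)" using nb max[OF \<open>h < ?l\<close>] by blast
  moreover have "p ! j = f (p ! i)" using nb e[OF i(1)] max[OF \<open>j < ?l\<close>] unfolding j_def by blast
  ultimately show False
    using p(2) \<open>j < ?l\<close> \<open>h < ?l\<close> \<open>j \<noteq> h\<close> nth_eq_iff_index_eq by metis
qed

text \<open>
  By induction on the height: if \<open>{v, f v}\<close> were the edge from \<open>f v\<close> to its \<open>g\<close>-parent \<open>v\<close>, then \<open>f\<close> and \<open>g\<close>,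
  which agree at the lower vertex \<open>f v\<close>, would both map it back to \<open>v\<close>.
\<close>

lemma forest_determined_by_edges:
  assumes f: "f \<in> {..<n} \<rightarrow>\<^sub>E {..n}" "parent_forest n f"
    and g: "g \<in> {..<n} \<rightarrow>\<^sub>E {..n}"
    and "forest_roots n f = forest_roots n g" "forest_edges n f = forest_edges n g"
  shows "f = g"
proof -
  obtain d :: "nat \<Rightarrow> nat" where d: "\<And>i. i < n \<Longrightarrow> d (f i) < d i"
    using f unfolding parent_forest_def by blast
  have "f v = g v" if "v < n" for v
    using that
  proof (induction v rule: measure_induct_rule[of d])
    case (less v)
    have roots: "f i = n \<longleftrightarrow> g i = n" if "i < n" for i
      using assms(4) that by (auto simp: forest_roots_def)
    show ?case
    proof (cases "f v = n")
      case True
      then show ?thesis using roots less.prems by simp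
    next
      case False
      have "f v \<le> n" using f(1) less.prems by (auto simp: PiE_iff)
      then have fv: "f v < n" using False by simp
      have "{v, f v} \<in> forest_edges n g"
        using False less.prems assms(5) by (auto simp: forest_edges_def)
      then obtain i where i: "i < n" "g i \<noteq> n" "{v, f v} = {i, g i}"
        by (auto simp: forest_edges_def)
      then consider "i = v" "f v = g v" | "i = f v" "g (f v) = v"
        by (auto simp: doubleton_eq_iff)
      then show ?thesis
      proof cases
        case 2
        have "f (f v) = g (f v)" using less.IH[OF d[OF less.prems] fv] .
        then have "f (f v) = v" using 2 by simp
        then show ?thesis using d[OF less.prems] d[OF fv] by simp
      qed simp
    qed
  qed
  then show ?thesis using f(1) g by (intro PiE_ext[OF f(1) g]) simp
qed

lemma tree_from_forest:
  assumes f: "f \<in> {..<n} \<rightarrow>\<^sub>E {..n}" "parent_forest n f" "forest_roots n f = {r}"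
  shows "tree \<lparr>vertices = {..<n}, edges = forest_edges n f\<rparr>"
proof -
  let ?R = "adj_rel (forest_edges n f)"
  have "sym (?R\<^sup>*)" by (intro sym_rtrancl) (auto simp: sym_def insert_commute)
  have "(u, v) \<in> ?R\<^sup>*" if "u < n" "v < n" for u v
  proof -
    have "(u, r) \<in> ?R\<^sup>*" "(v, r) \<in> ?R\<^sup>*" using forest_connected_to_root[OF f] that by blast+
    then show ?thesis using \<open>sym (?R\<^sup>*)\<close> by (meson rtrancl_trans symD)
  qed
  moreover have "r < n" using f(3) by (auto simp: forest_roots_def)
  ultimately show ?thesis
    using forest_no_cycle[OF f(2)] by (auto simp: tree_def connected_graph_def)
qed

text \<open>
  Each vertex other than \<open>r\<close> chooses a neighbour closer to \<open>r\<close> as its parent. The chosen edges form a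
  connected subgraph, which is all of the tree.
\<close>

lemma forest_from_tree:
  assumes simple: "\<And>e. e \<in> E \<Longrightarrow> \<exists>i j. e = {i, j} \<and> i < n \<and> j < n \<and> i \<noteq> j"
    and T: "tree \<lparr>vertices = {..<n}, edges = E\<rparr>" and "r < n"
  shows "\<exists>f\<in>forests_in n E. forest_roots n f = {r} \<and> forest_edges n f = E"
proof -
  let ?R = "adj_rel E"
  have conn: "(v, r) \<in> ?R\<^sup>*" if "v < n" for v
    using T that \<open>r < n\<close> by (simp add: tree_def connected_graph_def)
  define d where "d = (\<lambda>v. LEAST m. (v, r) \<in> ?R ^^ m)"
  have d: "(v, r) \<in> ?R ^^ d v" if "v < n" for v
    unfolding d_def using conn[OF that] by (rule LeastI_ex[OF iffD1[OF rtrancl_power]])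
  have "\<exists>u<n. {v, u} \<in> E \<and> d u < d v" if "v < n" "v \<noteq> r" for v
  proof -
    have "d v \<noteq> 0" using d[OF that(1)] that(2) by (intro notI) simp
    then obtain m where m: "d v = Suc m" by (cases "d v") auto
    then have "(v, r) \<in> ?R ^^ Suc m" using d[OF that(1)] by simp
    then obtain u where u: "{v, u} \<in> E" "(u, r) \<in> ?R ^^ m"
      by (blast dest: relpow_Suc_D2)
    have "d u \<le> m" unfolding d_def using u(2) by (rule Least_le)
    moreover have "u < n" using simple[OF u(1)] by (auto simp: doubleton_eq_iff)
    ultimately show ?thesis using u(1) m by auto
  qed
  then have "\<forall>v. \<exists>u. v < n \<and> v \<noteq> r \<longrightarrow> u < n \<and> {v, u} \<in> E \<and> d u < d v" by blast
  from choice[OF this] obtain p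
    where p: "\<And>v. v < n \<Longrightarrow> v \<noteq> r \<Longrightarrow> p v < n \<and> {v, p v} \<in> E \<and> d (p v) < d v"
    by blast
  define f where "f = (\<lambda>v. if v < n then if v = r then n else p v else undefined)"
  have fn: "f \<in> {..<n} \<rightarrow>\<^sub>E {..n}"
    using p by (auto simp: f_def PiE_iff extensional_def less_imp_le)
  have pf: "parent_forest n f"
    unfolding parent_forest_def
  proof (intro exI allI impI)
    fix i assume "i < n"
    then show "(if f i = n then 0 else Suc (d (f i))) < (if i = n then 0 else Suc (d i))"
      using p[of i] by (cases "i = r") (simp_all add: f_def)
  qed
  have roots: "forest_roots n f = {r}"
  proof -
    have "p v \<noteq> n" if "v < n" "v \<noteq> r" for v using p[OF that] by simp
    then show ?thesis using \<open>r < n\<close> by (auto simp: forest_roots_def f_def)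
  qed
  have sub: "forest_edges n f \<subseteq> E"
    unfolding forest_edges_def using p by (fastforce simp: f_def)
  have "forest_edges n f = E"
  proof (rule connected_subgraph_of_acyclic[OF sub])
    show "{x} \<notin> E" for x using simple[of "{x}"] by auto
    show "\<nexists>p. is_cycle \<lparr>vertices = {..<n}, edges = E\<rparr> p" using T by (simp add: tree_def)
    show "\<exists>x y. e = {x, y}" if "e \<in> E" for e using simple[OF that] by blast
    show "(x, y) \<in> (adj_rel (forest_edges n f))\<^sup>*" if "{x, y} \<in> E" for x y
    proof -
      have "x < n" "y < n" using simple[OF that] by (auto simp: doubleton_eq_iff)
      then show ?thesis using tree_from_forest[OF fn pf roots]
        by (auto simp: tree_def connected_graph_def)
    qed
  qed
  then show ?thesis using fn pf roots by (auto simp: forests_in_def)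
qed

text \<open>
  A forest with a single root amounts to a spanning tree together with the choice of that root.
\<close>

theorem card_single_rooted_forests:
  assumes simple: "\<And>e. e \<in> E \<Longrightarrow> \<exists>i j. e = {i, j} \<and> i < n \<and> j < n \<and> i \<noteq> j"
  shows "card {f \<in> forests_in n E. card (forest_roots n f) = 1} =
    n * num_spanning_trees \<lparr>vertices = {..<n}, edges = E\<rparr>"
proof -
  let ?A = "{f \<in> forests_in n E. card (forest_roots n f) = 1}"
  let ?G = "\<lparr>vertices = {..<n}, edges = E\<rparr>"
  let ?h = "\<lambda>f. (the_elem (forest_roots n f), \<lparr>vertices = {..<n}, edges = forest_edges n f\<rparr>)"
  have "bij_betw ?h ?A ({..<n} \<times> {T. spanning_tree T ?G})"
  proof (rule bij_betw_imageI)
    show "inj_on ?h ?A"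
    proof (rule inj_onI)
      fix f g assume *: "f \<in> ?A" "g \<in> ?A" "?h f = ?h g"
      then have "forest_roots n f = forest_roots n g"
        by (auto simp: card_1_singleton_iff)
      with * show "f = g"
        by (intro forest_determined_by_edges[of f n g]) (auto simp: forests_in_def)
    qed
    show "?h ` ?A = {..<n} \<times> {T. spanning_tree T ?G}"
    proof (intro equalityI subsetI)
      fix x assume "x \<in> ?h ` ?A"
      then obtain f r where f: "f \<in> forests_in n E" "forest_roots n f = {r}" "x = ?h f"
        by (auto simp: card_1_singleton_iff)
      then have "r < n" by (auto simp: forest_roots_def)
      moreover have "tree \<lparr>vertices = {..<n}, edges = forest_edges n f\<rparr>"
        using f tree_from_forest by (auto simp: forests_in_def)
      ultimately show "x \<in> {..<n} \<times> {T. spanning_tree T ?G}"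
        using f by (auto simp: spanning_tree_def forests_in_def)
    next
      fix x assume "x \<in> {..<n} \<times> {T. spanning_tree T ?G}"
      then obtain r T where x: "x = (r, T)" "r < n" "spanning_tree T ?G" by auto
      then have T: "T = \<lparr>vertices = {..<n}, edges = edges T\<rparr>" "edges T \<subseteq> E" "tree T"
        by (auto simp: spanning_tree_def)
      obtain f where f: "f \<in> forests_in n (edges T)" "forest_roots n f = {r}"
        "forest_edges n f = edges T"
        using forest_from_tree[of "edges T" n r] simple T x(2) by (metis subsetD)
      then have "f \<in> ?A" using T(2) by (auto simp: forests_in_def)
      moreover have "x = ?h f" using x(1) f T(1) by simp
      ultimately show "x \<in> ?h ` ?A" by blast
    qed
  qed
  then show ?thesis
    by (auto simp: num_spanning_trees_def card_cartesian_product dest: bij_betw_same_card)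
qed

text \<open>
  The matrix-tree theorem with weight 1 on edges and weight \<open>x\<close> on becoming a root.
\<close>

theorem det_shifted_laplacian:
  fixes x :: "'a::idom"
  assumes simple: "\<And>e. e \<in> E \<Longrightarrow> \<exists>i j. e = {i, j} \<and> i < n \<and> j < n \<and> i \<noteq> j"
  shows "det (mat n n (\<lambda>(i, j). (if i = j then x + (\<Sum>l<n. of_bool ({i, l} \<in> E)) else 0) -
      of_bool ({i, j} \<in> E))) = (\<Sum>f\<in>forests_in n E. x ^ card (forest_roots n f))"
proof -
  define w where "w = (\<lambda>i l. if l = n then x else of_bool ({i, l} \<in> E))"
  have "(\<Sum>l\<le>n. w i l) = x + (\<Sum>l<n. of_bool ({i, l} \<in> E))" for i
  proof -
    have "(\<Sum>l\<le>n. w i l) = (\<Sum>l<n. w i l) + w i n"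
      unfolding lessThan_Suc_atMost[symmetric] by simp
    also have "(\<Sum>l<n. w i l) = (\<Sum>l<n. of_bool ({i, l} \<in> E))"
      by (intro sum.cong) (auto simp: w_def)
    finally show ?thesis by (simp add: w_def)
  qed
  then have "mat n n (\<lambda>(i, j). (if i = j then x + (\<Sum>l<n. of_bool ({i, l} \<in> E)) else 0) -
      of_bool ({i, j} \<in> E)) = mat n n (\<lambda>(i, j). (if i = j then \<Sum>l\<le>n. w i l else 0) - w i j)"
    by (intro eq_matI) (simp_all add: w_def)
  then have "det (mat n n (\<lambda>(i, j). (if i = j then x + (\<Sum>l<n. of_bool ({i, l} \<in> E)) else 0) -
      of_bool ({i, j} \<in> E))) =
      (\<Sum>f | f \<in> {..<n} \<rightarrow>\<^sub>E {..n} \<and> parent_forest n f. \<Prod>i<n. w i (f i))"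
    by (simp add: det_laplacian_forests)
  also have "\<dots> = (\<Sum>f | f \<in> {..<n} \<rightarrow>\<^sub>E {..n} \<and> parent_forest n f.
      if forest_edges n f \<subseteq> E then x ^ card (forest_roots n f) else 0)"
  proof (intro sum.cong refl)
    fix f
    have "(\<Prod>i<n. w i (f i)) = (\<Prod>i\<in>{..<n} - forest_roots n f. w i (f i)) *
        (\<Prod>i\<in>forest_roots n f. w i (f i))"
      by (rule prod.subset_diff) (auto simp: forest_roots_def)
    also have "(\<Prod>i\<in>{..<n} - forest_roots n f. w i (f i)) =
        (\<Prod>i\<in>{..<n} - forest_roots n f. of_bool ({i, f i} \<in> E))"
      by (intro prod.cong) (auto simp: w_def forest_roots_def)
    also have "(\<Prod>i\<in>forest_roots n f. w i (f i)) = x ^ card (forest_roots n f)"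
      by (simp add: w_def forest_roots_def)
    finally have "(\<Prod>i<n. w i (f i)) = (\<Prod>i\<in>{..<n} - forest_roots n f. of_bool ({i, f i} \<in> E)) *
        x ^ card (forest_roots n f)" .
    moreover have "(\<Prod>i\<in>{..<n} - forest_roots n f. of_bool ({i, f i} \<in> E)) =
        (of_bool (forest_edges n f \<subseteq> E) :: 'a)"
    proof (cases "forest_edges n f \<subseteq> E")
      case True
      then have "(\<Prod>i\<in>{..<n} - forest_roots n f. of_bool ({i, f i} \<in> E)) = (1 :: 'a)"
        by (intro prod.neutral) (auto simp: forest_edges_def forest_roots_def)
      with True show ?thesis by simp
    next
      case False
      then have "(\<Prod>i\<in>{..<n} - forest_roots n f. of_bool ({i, f i} \<in> E)) = (0 :: 'a)"
        by (intro prod_zero) (auto simp: forest_edges_def forest_roots_def)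
      with False show ?thesis by simp
    qed
    ultimately show "(\<Prod>i<n. w i (f i)) =
        (if forest_edges n f \<subseteq> E then x ^ card (forest_roots n f) else 0)" by simp
  qed
  also have "\<dots> = (\<Sum>f\<in>forests_in n E. x ^ card (forest_roots n f))"
  proof -
    have "finite {f. f \<in> {..<n} \<rightarrow>\<^sub>E {..n} \<and> parent_forest n f}"
      by (rule finite_subset[of _ "{..<n} \<rightarrow>\<^sub>E {..n}"]) (auto intro: finite_PiE)
    then show ?thesis
      by (subst sum.inter_filter[symmetric]) (auto simp: forests_in_def intro!: sum.cong)
  qed
  finally show ?thesis .
qed

section \<open>Spanning trees of circulant graphs\<close>

abbreviation unity_root :: "nat \<Rightarrow> nat \<Rightarrow> complex" where
  "unity_root n m \<equiv> cis (2 * pi * (real m / real n))"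

text \<open>
  If the columns of the Fourier matrix \<open>F\<close> are eigenvectors of \<open>A\<close>, then \<open>A F = F D\<close> with \<open>D\<close> diagonal, and
  \<open>F\<close> is invertible by orthogonality of characters.
\<close>

lemma det_eq_prod_fourier_eigenvalues:
  fixes A :: "complex mat"
  assumes A: "A \<in> carrier_mat n n" and "n > 0"
    and eigen: "\<And>m i. m < n \<Longrightarrow> i < n \<Longrightarrow>
      (\<Sum>j<n. A $$ (i, j) * unity_root n m ^ j) = \<mu> m * unity_root n m ^ i"
  shows "det A = (\<Prod>m<n. \<mu> m)"
proof -
  let ?z = "unity_root n"
  define F where "F = mat n n (\<lambda>(j, m). ?z m ^ j)"
  define G where "G = mat n n (\<lambda>(m, l). inverse (?z m) ^ l)"
  define D where "D = mat n n (\<lambda>(i, m). if i = m then \<mu> m else 0)"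
  have carr: "F \<in> carrier_mat n n" "G \<in> carrier_mat n n" "D \<in> carrier_mat n n"
    by (simp_all add: F_def G_def D_def)
  have z_nz: "?z m \<noteq> 0" for m by simp
  have z_pow_n: "?z m ^ n = 1" for m
    using \<open>n > 0\<close> by (simp add: Complex.DeMoivre cis_multiple_2pi)
  have swap: "?z m ^ j = ?z j ^ m" for m j by (simp add: Complex.DeMoivre mult_ac)
  have z_inj: "?z j \<noteq> ?z l" if "j < n" "l < n" "j \<noteq> l" for j l
    using Complex.bij_betw_roots_unity[OF \<open>n > 0\<close>] that
    by (auto simp: bij_betw_def inj_on_def)
  have "F * G = of_nat n \<cdot>\<^sub>m 1\<^sub>m n"
  proof (rule eq_matI)
    fix j l assume "j < dim_row (of_nat n \<cdot>\<^sub>m 1\<^sub>m n :: complex mat)"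
      "l < dim_col (of_nat n \<cdot>\<^sub>m 1\<^sub>m n :: complex mat)"
    then have jl: "j < n" "l < n" by simp_all
    have "(F * G) $$ (j, l) = (\<Sum>m<n. ?z m ^ j * inverse (?z m) ^ l)"
      using jl by (simp add: F_def G_def scalar_prod_def atLeast0LessThan)
    also have "\<dots> = (\<Sum>m<n. (?z j / ?z l) ^ m)"
    proof (rule sum.cong[OF refl])
      fix m
      show "?z m ^ j * inverse (?z m) ^ l = (?z j / ?z l) ^ m"
        unfolding power_inverse power_divide divide_inverse[of "_ ^ _"] swap[of m] ..
    qed
    also have "\<dots> = (if j = l then of_nat n else 0)"
    proof (cases "j = l")
      case False
      then have "?z j / ?z l \<noteq> 1" using z_inj[OF jl] z_nz by simp
      then have "(\<Sum>m<n. (?z j / ?z l) ^ m) = ((?z j / ?z l) ^ n - 1) / (?z j / ?z l - 1)"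
        by (rule geometric_sum)
      also have "(?z j / ?z l) ^ n = 1" by (simp only: power_divide z_pow_n) simp
      finally show ?thesis using False by simp
    qed simp
    finally show "(F * G) $$ (j, l) = (of_nat n \<cdot>\<^sub>m 1\<^sub>m n) $$ (j, l)" using jl by simp
  qed (simp_all add: F_def G_def)
  then have "det F * det G = of_nat n ^ n"
    using det_mult[OF carr(1,2)] by simp
  then have "det F \<noteq> 0" using \<open>n > 0\<close> by auto
  have "A * F = F * D"
  proof (rule eq_matI)
    fix i m assume "i < dim_row (F * D)" "m < dim_col (F * D)"
    then have im: "i < n" "m < n" using carr by auto
    have "(A * F) $$ (i, m) = (\<Sum>j<n. A $$ (i, j) * ?z m ^ j)"
      using im A by (simp add: F_def scalar_prod_def atLeast0LessThan)
    also have "\<dots> = \<mu> m * ?z m ^ i" using eigen im by simp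
    also have "\<dots> = (\<Sum>j<n. if j = m then ?z j ^ i * \<mu> m else 0)"
      using im by simp
    also have "\<dots> = (\<Sum>j<n. ?z j ^ i * (if j = m then \<mu> m else 0))"
      by (intro sum.cong) auto
    also have "\<dots> = (F * D) $$ (i, m)"
      using im by (simp add: F_def D_def scalar_prod_def atLeast0LessThan)
    finally show "(A * F) $$ (i, m) = (F * D) $$ (i, m)" .
  qed (use A carr in auto)
  then have "det A * det F = det F * det D"
    using det_mult[OF A carr(1)] det_mult[OF carr(1,3)] by (simp only:)
  then have "det A = det D" using \<open>det F \<noteq> 0\<close> by simp
  also have "\<dots> = (\<Prod>m<n. \<mu> m)"
  proof -
    have "upper_triangular D" by (auto simp: D_def)
    then have "det D = prod_list (diag_mat D)" using carr(3) by (rule det_upper_triangular)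
    also have "\<dots> = (\<Prod>m<n. \<mu> m)"
      by (simp add: prod_list_diag_prod D_def atLeast0LessThan)
    finally show ?thesis .
  qed
  finally show ?thesis .
qed

definition sine_symbol :: "nat set \<Rightarrow> real \<Rightarrow> real" where
  "sine_symbol S t = (\<Sum>a\<in>S. (2 * sin (pi * real a * t))\<^sup>2)"

text \<open>
  The right-hand side is the Laurent polynomial \<open>L\<close> at \<open>e\<^sup>2\<^sup>\<pi>\<^sup>i\<^sup>t\<close>.
\<close>

lemma sine_symbol_cis:
  fixes t :: real
  assumes "finite S"
  shows "complex_of_real (sine_symbol S t) =
    2 * of_nat (card S) - (\<Sum>a\<in>S. cis (2 * pi * t) ^ a + inverse (cis (2 * pi * t)) ^ a)"
proof -
  have "complex_of_real ((2 * sin (pi * real a * t))\<^sup>2) =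
      2 - (cis (2 * pi * t) ^ a + inverse (cis (2 * pi * t)) ^ a)" for a
  proof -
    have "(2 * sin (pi * real a * t))\<^sup>2 = 2 - 2 * cos (real a * (2 * pi * t))"
      using cos_double_sin[of "pi * real a * t"] by (simp add: power_mult_distrib mult_ac)
    moreover have "cis (2 * pi * t) ^ a + inverse (cis (2 * pi * t)) ^ a =
        complex_of_real (2 * cos (real a * (2 * pi * t)))"
      by (simp add: Complex.DeMoivre complex_eq_iff)
    ultimately show ?thesis by simp
  qed
  then show ?thesis
    by (simp add: sine_symbol_def sum_subtractf)
qed

lemma circulant_adjacent_iff:
  assumes "i < n" "j < n" and S: "\<And>a. a \<in> S \<Longrightarrow> a < n"
  shows "{i, j} \<in> edges (circulant n S) \<longleftrightarrow>
    (\<exists>a\<in>S. j = (i + a) mod n \<or> j = (i + (n - a)) mod n)"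
proof -
  have plus: "[int j = int i + int a] (mod int n) \<longleftrightarrow> j = (i + a) mod n"
    if "j < n" for i j a
    using that by (simp add: cong_def zmod_int[symmetric] of_nat_add[symmetric] del: of_nat_add)
  have minus: "[int j = int i - int a] (mod int n) \<longleftrightarrow> j = (i + (n - a)) mod n"
    if "j < n" "a < n" for i j a
  proof -
    have "[int j = int i - int a] (mod int n) \<longleftrightarrow> [int j = int i - int a + int n] (mod int n)"
      by (simp add: cong_def)
    also have "int i - int a + int n = int i + int (n - a)" using that by simp
    finally show ?thesis using plus[OF that(1)] by simp
  qed
  have sym: "[int i = int j + int a] (mod int n) \<longleftrightarrow> [int j = int i - int a] (mod int n)"
    "[int i = int j - int a] (mod int n) \<longleftrightarrow> [int j = int i + int a] (mod int n)" for i j a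
    using dvd_minus_iff[of "int n" "int i - int j - int a"]
      dvd_minus_iff[of "int n" "int i - int j + int a"]
    by (simp_all add: cong_iff_dvd_diff algebra_simps)
  have "{i, j} \<in> edges (circulant n S) \<longleftrightarrow>
    (\<exists>a\<in>S. [int j = int i + int a] (mod int n) \<or> [int j = int i - int a] (mod int n))"
    using assms(1,2) sym by (auto simp: circulant_def doubleton_eq_iff)
  then show ?thesis using plus minus assms by auto
qed

lemma circulant_edge_pair:
  assumes "e \<in> edges (circulant n S)" and S: "\<And>a. a \<in> S \<Longrightarrow> 0 < a \<and> 2 * a < n"
  shows "\<exists>i j. e = {i, j} \<and> i < n \<and> j < n \<and> i \<noteq> j"
proof -
  obtain i j a where e: "e = {i, j}" "i < n" "j < n" "a \<in> S"
    "[int j = int i + int a] (mod int n) \<or> [int j = int i - int a] (mod int n)"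
    using assms(1) by (auto simp: circulant_def)
  have "i \<noteq> j"
  proof
    assume "i = j"
    then have "int n dvd int a" using e(5) by (auto simp: cong_iff_dvd_diff)
    then show False using S[OF e(4)] by (auto dest: dvd_imp_le)
  qed
  then show ?thesis using e by blast
qed

text \<open>
  The neighbours of \<open>i\<close> are the translates of \<open>i\<close> by \<open>a\<close> and by \<open>n - a\<close>. Since \<open>0 < 2 a < n\<close>, these shifts are
  pairwise distinct residues, so every neighbour is counted once.
\<close>

lemma circulant_neighbour_sum:
  fixes z :: complex
  assumes "z ^ n = 1" "i < n" "finite S" and S: "\<And>a. a \<in> S \<Longrightarrow> 0 < a \<and> 2 * a < n"
  shows "(\<Sum>j<n. of_bool ({i, j} \<in> edges (circulant n S)) * z ^ j) =
    z ^ i * (\<Sum>a\<in>S. z ^ a + inverse z ^ a)"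
proof -
  have "z \<noteq> 0" using assms(1,2) by (auto simp: power_0_left split: if_splits)
  define D where "D = S \<union> (\<lambda>a. n - a) ` S"
  have less: "a < n" if "a \<in> S" for a using S[OF that] by simp
  have D_less: "c < n" if "c \<in> D" for c using that S less by (fastforce simp: D_def)
  have inj: "inj_on (\<lambda>c. (i + c) mod n) D"
  proof (rule inj_onI)
    fix b c assume bc: "b \<in> D" "c \<in> D" "(i + b) mod n = (i + c) mod n"
    then have "[b = c] (mod n)" by (simp add: cong_add_lcancel_nat flip: cong_def)
    then show "b = c" using D_less bc by (auto intro: cong_less_modulus_unique_nat)
  qed
  have nbrs: "{j. j < n \<and> {i, j} \<in> edges (circulant n S)} = (\<lambda>c. (i + c) mod n) ` D"
    using assms(2) circulant_adjacent_iff[of i n _ S] less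
    by (auto simp: D_def image_Un image_image)
  have pow_mod: "z ^ (m mod n) = z ^ m" for m
  proof -
    have "z ^ m = z ^ (n * (m div n) + m mod n)" by simp
    also have "\<dots> = z ^ (m mod n)" by (simp only: power_add power_mult assms(1) power_one mult_1_left)
    finally show ?thesis by simp
  qed
  have "(\<Sum>j<n. of_bool ({i, j} \<in> edges (circulant n S)) * z ^ j) =
      (\<Sum>j | j < n \<and> {i, j} \<in> edges (circulant n S). z ^ j)"
    by (rule sum.mono_neutral_cong_right) auto
  also have "\<dots> = (\<Sum>c\<in>D. z ^ (i + c))"
    unfolding nbrs by (simp add: sum.reindex[OF inj] pow_mod)
  also have "\<dots> = (\<Sum>a\<in>S. z ^ (i + a)) + (\<Sum>c\<in>(\<lambda>a. n - a) ` S. z ^ (i + c))"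
    unfolding D_def
  proof (rule sum.union_disjoint)
    show "S \<inter> (\<lambda>a. n - a) ` S = {}"
    proof (rule ccontr)
      assume "\<not> ?thesis"
      then obtain a b where "a \<in> S" "b \<in> S" "a = n - b" by blast
      then show False using S[of a] S[of b] by arith
    qed
  qed (use \<open>finite S\<close> in auto)
  also have "(\<Sum>c\<in>(\<lambda>a. n - a) ` S. z ^ (i + c)) = (\<Sum>a\<in>S. z ^ (i + (n - a)))"
  proof (subst sum.reindex)
    show "inj_on (\<lambda>a. n - a) S"
    proof (rule inj_onI)
      fix a b assume "a \<in> S" "b \<in> S" "n - a = n - b"
      then show "a = b" using less[of a] less[of b] by linarith
    qed
  qed simp
  also have "\<dots> = (\<Sum>a\<in>S. z ^ i * inverse z ^ a)"
  proof (rule sum.cong[OF refl])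
    fix a assume "a \<in> S"
    then have "z ^ (n - a) * z ^ a = 1" using less[of a] assms(1) by (simp flip: power_add)
    then have "z ^ (n - a) = inverse z ^ a"
      using \<open>z \<noteq> 0\<close> by (simp add: field_simps power_inverse)
    then show "z ^ (i + (n - a)) = z ^ i * inverse z ^ a" by (simp only: power_add)
  qed
  finally show ?thesis by (simp add: power_add sum_distrib_left sum.distrib distrib_left)
qed

text \<open>
  A vertex of minimal height has no parent among the vertices.
\<close>

lemma forest_roots_nonempty:
  assumes "f \<in> {..<n} \<rightarrow>\<^sub>E {..n}" "parent_forest n f" "n > 0"
  shows "card (forest_roots n f) > 0"
proof -
  obtain d :: "nat \<Rightarrow> nat" where d: "\<And>i. i < n \<Longrightarrow> d (f i) < d i"
    using assms(2) unfolding parent_forest_def by blast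
  obtain i where i: "i < n" "\<And>j. j < n \<Longrightarrow> d i \<le> d j"
    using ex_has_least_nat[of "\<lambda>i. i < n" 0 d] assms(3) by blast
  have "f i \<le> n" using assms(1) i(1) by (auto simp: PiE_iff)
  moreover have "\<not> f i < n" using i(2) d[OF i(1)] by (meson leD)
  ultimately have "i \<in> forest_roots n f" using i(1) by (simp add: forest_roots_def)
  moreover have "finite (forest_roots n f)" by (simp add: forest_roots_def)
  ultimately show ?thesis by (auto simp: card_gt_0_iff)
qed

text \<open>
  The linear coefficient is extracted by dividing by \<open>x\<close> and letting \<open>x\<close> tend to 0, where \<open>0 ^ 0 = 1\<close> leaves
  exactly the terms of exponent one.
\<close>

lemma card_exponent_one_eq_linear_coeff:
  fixes P :: "complex \<Rightarrow> complex"
  assumes "finite F" "\<And>f. f \<in> F \<Longrightarrow> r f > 0" "isCont P 0"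
    and eq: "\<And>x. (\<Sum>f\<in>F. x ^ r f) = x * P x"
  shows "of_nat (card {f \<in> F. r f = 1}) = P 0"
proof -
  have "isCont (\<lambda>x::complex. \<Sum>f\<in>F. x ^ (r f - 1)) 0" by (intro continuous_intros)
  then have lim: "(\<lambda>x::complex. \<Sum>f\<in>F. x ^ (r f - 1)) \<midarrow>0\<rightarrow> (\<Sum>f\<in>F. 0 ^ (r f - 1))"
    by (simp only: isCont_def)
  have "(\<Sum>f\<in>F. x ^ (r f - 1)) = P x" if "x \<noteq> 0" for x
  proof -
    have "x * (\<Sum>f\<in>F. x ^ (r f - 1)) = (\<Sum>f\<in>F. x ^ r f)"
      unfolding sum_distrib_left using assms(2)
      by (intro sum.cong) (auto simp flip: power_Suc)
    then show ?thesis using eq[of x] that by simp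
  qed
  then have "\<forall>\<^sub>F x in at 0. (\<Sum>f\<in>F. x ^ (r f - 1)) = P x"
    by (simp add: eventually_at_filter)
  with lim have "P \<midarrow>0\<rightarrow> (\<Sum>f\<in>F. 0 ^ (r f - 1))"
    by (rule Lim_transform_eventually)
  then have "P 0 = (\<Sum>f\<in>F. 0 ^ (r f - 1))"
    using assms(3) unfolding isCont_def by (intro tendsto_unique[of "at 0" P]) simp_all
  also have "\<dots> = (\<Sum>f\<in>F. if r f = 1 then 1 else 0)"
  proof (rule sum.cong[OF refl])
    fix f assume "f \<in> F"
    then show "0 ^ (r f - 1) = (if r f = 1 then 1 else 0 :: complex)"
      using assms(2)[of f] by (cases "r f") (auto simp: power_0_left)
  qed
  also have "\<dots> = of_nat (card {f \<in> F. r f = 1})"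
    using assms(1) by (simp add: sum.If_cases Int_def)
  finally show ?thesis by simp
qed

text \<open>
  Both sides are the linear coefficient of \<open>det (x I + Laplacian)\<close>: the left one by counting forests, the
  right one because the eigenvalue for \<open>m = 0\<close> vanishes.
\<close>

theorem circulant_spanning_tree_formula:
  assumes "n > 0" "finite S" and S: "\<And>a. a \<in> S \<Longrightarrow> 0 < a \<and> 2 * a < n"
  shows "real (n * num_spanning_trees (circulant n S)) =
    (\<Prod>m = 1..<n. sine_symbol S (real m / real n))"
proof -
  define E where "E = edges (circulant n S)"
  have simple: "\<exists>i j. e = {i, j} \<and> i < n \<and> j < n \<and> i \<noteq> j" if "e \<in> E" for e
    using circulant_edge_pair[of e n S] that S by (simp add: E_def)
  have G: "circulant n S = \<lparr>vertices = {..<n}, edges = E\<rparr>" by (simp add: E_def circulant_def)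
  have nbr: "(\<Sum>j<n. of_bool ({i, j} \<in> E) * z ^ j) = z ^ i * (\<Sum>a\<in>S. z ^ a + inverse z ^ a)"
    if "z ^ n = 1" "i < n" for z :: complex and i
    unfolding E_def using circulant_neighbour_sum[OF that \<open>finite S\<close> S] .
  have degree: "(\<Sum>j<n. of_bool ({i, j} \<in> E)) = (2 * of_nat (card S) :: complex)" if "i < n" for i
    using nbr[of 1 i] that by simp
  let ?\<mu> = "\<lambda>m. complex_of_real (sine_symbol S (real m / real n))"
  have "(\<Sum>f\<in>forests_in n E. x ^ card (forest_roots n f)) = x * (\<Prod>m = 1..<n. x + ?\<mu> m)"
    for x :: complex
  proof -
    let ?A = "mat n n (\<lambda>(i, j). (if i = j then x + (\<Sum>l<n. of_bool ({i, l} \<in> E)) else 0) -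
      of_bool ({i, j} \<in> E))"
    have "det ?A = (\<Prod>m<n. x + ?\<mu> m)"
    proof (rule det_eq_prod_fourier_eigenvalues)
      fix m i assume mi: "m < n" "i < n"
      let ?z = "unity_root n m"
      have zn: "?z ^ n = 1" using \<open>n > 0\<close> by (simp add: Complex.DeMoivre cis_multiple_2pi)
      have "(\<Sum>j<n. ?A $$ (i, j) * ?z ^ j) =
          (\<Sum>j<n. (if j = i then (x + 2 * of_nat (card S)) * ?z ^ i else 0) -
            of_bool ({i, j} \<in> E) * ?z ^ j)"
        unfolding degree[OF mi(2), symmetric]
        using mi by (intro sum.cong refl) (auto simp: left_diff_distrib)
      also have "\<dots> = (x + 2 * of_nat (card S)) * ?z ^ i -
          ?z ^ i * (\<Sum>a\<in>S. ?z ^ a + inverse ?z ^ a)"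
        using mi nbr[OF zn mi(2)] by (simp only: sum_subtractf sum.delta finite_lessThan lessThan_iff if_True)
      also have "\<dots> = (x + ?\<mu> m) * ?z ^ i"
        by (simp only: sine_symbol_cis[OF \<open>finite S\<close>]) (simp add: algebra_simps)
      finally show "(\<Sum>j<n. ?A $$ (i, j) * ?z ^ j) = (x + ?\<mu> m) * ?z ^ i" .
    qed (use \<open>n > 0\<close> in simp_all)
    also have "\<dots> = (x + ?\<mu> 0) * (\<Prod>m = 1..<n. x + ?\<mu> m)"
      using \<open>n > 0\<close> by (simp add: lessThan_atLeast0 prod.atLeast_Suc_lessThan)
    also have "?\<mu> 0 = 0" by (simp add: sine_symbol_def)
    finally show ?thesis
      using det_shifted_laplacian[of E n x, OF simple] by (simp only: add_0_right)
  qed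
  moreover have "finite (forests_in n E)"
    by (rule finite_subset[of _ "{..<n} \<rightarrow>\<^sub>E {..n}"]) (auto simp: forests_in_def intro: finite_PiE)
  ultimately have "of_nat (card {f \<in> forests_in n E. card (forest_roots n f) = 1}) =
      (\<Prod>m = 1..<n. 0 + ?\<mu> m)"
    using \<open>n > 0\<close> forest_roots_nonempty
    by (intro card_exponent_one_eq_linear_coeff[where P = "\<lambda>x. \<Prod>m = 1..<n. x + ?\<mu> m"])
       (auto simp: forests_in_def intro!: continuous_intros)
  then have "complex_of_real (real (n * num_spanning_trees (circulant n S))) =
      complex_of_real (\<Prod>m = 1..<n. sine_symbol S (real m / real n))"
    using card_single_rooted_forests[OF simple] by (simp add: G)
  then show ?thesis by (simp only: of_real_eq_iff)
qed

section \<open>The Laurent polynomial on the unit circle\<close>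

text \<open>
  Bezout's theorem for finite sets, in the form in which it serves both for the lower bound on the symbol
  and for connectivity: a set of integers closed under subtraction is an ideal.
\<close>

lemma int_Gcd_mem_if_diff_closed:
  fixes S :: "nat set" and D :: "int set"
  assumes "finite S" "S \<noteq> {}" and sub: "\<And>a. a \<in> S \<Longrightarrow> int a \<in> D"
    and diff: "\<And>x y. x \<in> D \<Longrightarrow> y \<in> D \<Longrightarrow> x - y \<in> D"
  shows "int (Gcd S) \<in> D"
proof -
  have zero: "0 \<in> D" using diff sub \<open>S \<noteq> {}\<close> by (metis all_not_in_conv diff_self)
  have neg: "- x \<in> D" if "x \<in> D" for x using diff[OF zero that] by simp
  have add: "x + y \<in> D" if "x \<in> D" "y \<in> D" for x y
    using diff[OF that(1) neg[OF that(2)]] by simp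
  have nat_mult: "int m * x \<in> D" if "x \<in> D" for m x
    by (induction m) (use zero add that in \<open>auto simp: distrib_right\<close>)
  have mult: "c * x \<in> D" if "x \<in> D" for c x
    using nat_mult[OF that, of "nat \<bar>c\<bar>"] neg by (cases "c \<ge> 0") force+
  from \<open>finite S\<close> \<open>S \<noteq> {}\<close> sub show ?thesis
  proof (induction S rule: finite_ne_induct)
    case (singleton a)
    then show ?case by simp
  next
    case (insert a S)
    obtain u v where "u * int a + v * int (Gcd S) = int (gcd a (Gcd S))"
      using bezout_int[of "int a" "int (Gcd S)"] by auto
    moreover have "u * int a + v * int (Gcd S) \<in> D"
      using insert by (intro add mult) auto
    ultimately show ?case by simp
  qed
qed

lemma abs_sin_diff_le:
  fixes x y :: real
  shows "\<bar>sin (x - y)\<bar> \<le> \<bar>sin x\<bar> + \<bar>sin y\<bar>"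
proof -
  have "\<bar>sin (x - y)\<bar> \<le> \<bar>sin x * cos y\<bar> + \<bar>cos x * sin y\<bar>"
    unfolding sin_diff by (rule abs_triangle_ineq4)
  also have "\<dots> \<le> \<bar>sin x\<bar> * 1 + 1 * \<bar>sin y\<bar>"
    unfolding abs_mult by (intro add_mono mult_mono) auto
  finally show ?thesis by simp
qed

text \<open>
  The integers \<open>x\<close> for which \<open>|sin(\<pi> x t)|\<close> is bounded by a multiple of \<open>\<Sum> |sin(\<pi> a t)|\<close>, uniformly in \<open>t\<close>, are
  closed under subtraction by the addition theorem, hence include the gcd. The Cauchy-Schwarz inequality
  turns the sum of absolute values into the sum of squares.
\<close>

lemma sine_symbol_lower_bound:
  assumes "finite S" "S \<noteq> {}"
  shows "\<exists>c>0. \<forall>t. c * (sin (pi * real (Gcd S) * t))\<^sup>2 \<le> sine_symbol S t"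
proof -
  define N where "N = (\<lambda>t. \<Sum>a\<in>S. \<bar>sin (pi * real a * t)\<bar>)"
  define D where "D = {x :: int. \<exists>A\<ge>0. \<forall>t. \<bar>sin (pi * of_int x * t)\<bar> \<le> A * N t}"
  have "int (Gcd S) \<in> D"
  proof (rule int_Gcd_mem_if_diff_closed[OF assms])
    fix a assume "a \<in> S"
    then have "\<bar>sin (pi * real a * t)\<bar> \<le> 1 * N t" for t
      using member_le_sum[of a S "\<lambda>a. \<bar>sin (pi * real a * t)\<bar>"] \<open>finite S\<close> by (simp add: N_def)
    then show "int a \<in> D" unfolding D_def by (auto intro!: exI[of _ 1])
  next
    fix x y assume "x \<in> D" "y \<in> D"
    then obtain A B where AB: "A \<ge> 0" "\<And>t. \<bar>sin (pi * of_int x * t)\<bar> \<le> A * N t"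
      "B \<ge> 0" "\<And>t. \<bar>sin (pi * of_int y * t)\<bar> \<le> B * N t"
      by (auto simp: D_def)
    have "\<bar>sin (pi * of_int (x - y) * t)\<bar> \<le> (A + B) * N t" for t
    proof -
      have "\<bar>sin (pi * of_int (x - y) * t)\<bar> \<le> \<bar>sin (pi * of_int x * t)\<bar> + \<bar>sin (pi * of_int y * t)\<bar>"
        using abs_sin_diff_le[of "pi * of_int x * t" "pi * of_int y * t"]
        by (simp add: algebra_simps)
      also have "\<dots> \<le> A * N t + B * N t" using AB by (intro add_mono)
      finally show ?thesis by (simp add: algebra_simps)
    qed
    then show "x - y \<in> D" using AB unfolding D_def by (auto intro!: exI[of _ "A + B"])
  qed
  then obtain A where A: "A \<ge> 0" "\<And>t. \<bar>sin (pi * real (Gcd S) * t)\<bar> \<le> A * N t"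
    by (auto simp: D_def)
  have N_sq: "4 * (N t)\<^sup>2 \<le> real (card S) * sine_symbol S t" for t
  proof -
    have "(N t)\<^sup>2 \<le> real (card S) * (\<Sum>a\<in>S. (sin (pi * real a * t))\<^sup>2)"
      using sum_squared_le_sum_of_squares[of "\<lambda>a. \<bar>sin (pi * real a * t)\<bar>" S] assms
      by (simp add: N_def mult.commute)
    moreover have "sine_symbol S t = 4 * (\<Sum>a\<in>S. (sin (pi * real a * t))\<^sup>2)"
      by (simp add: sine_symbol_def power_mult_distrib sum_distrib_left)
    ultimately show ?thesis by simp
  qed
  \<comment> \<open>The constant \<open>A\<close> may be 0; \<open>A + 1\<close> can be divided by.\<close>
  have pos: "(A + 1)\<^sup>2 * real (card S) > 0"
    using A assms by (simp add: card_gt_0_iff)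
  show ?thesis
  proof (intro exI conjI allI)
    show "4 / ((A + 1)\<^sup>2 * real (card S)) > 0" using pos by simp
    fix t
    have "\<bar>sin (pi * real (Gcd S) * t)\<bar> \<le> (A + 1) * N t"
      using A(2)[of t] by (rule order_trans) (auto simp: N_def intro!: mult_right_mono sum_nonneg)
    then have "(sin (pi * real (Gcd S) * t))\<^sup>2 \<le> ((A + 1) * N t)\<^sup>2"
      by (metis abs_ge_zero power2_abs power_mono)
    also have "4 * \<dots> \<le> (A + 1)\<^sup>2 * (real (card S) * sine_symbol S t)"
      using mult_left_mono[OF N_sq[of t], of "(A + 1)\<^sup>2"] by (simp add: power_mult_distrib mult_ac)
    finally show "4 / ((A + 1)\<^sup>2 * real (card S)) * (sin (pi * real (Gcd S) * t))\<^sup>2 \<le> sine_symbol S t"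
      using pos by (simp add: field_simps)
  qed
qed

lemma sine_symbol_upper_bound: "sine_symbol S t \<le> 4 * real (card S)"
proof -
  have "(2 * sin (pi * real a * t))\<^sup>2 \<le> 4" for a
  proof -
    have "(sin (pi * real a * t))\<^sup>2 \<le> 1" by (rule abs_square_le_1[THEN iffD2]) simp
    then show ?thesis by (simp add: power_mult_distrib)
  qed
  then have "sine_symbol S t \<le> (\<Sum>a\<in>S. 4)" unfolding sine_symbol_def by (intro sum_mono)
  then show ?thesis by simp
qed

text \<open>
  Jordan's inequality, by concavity of the sine on \<open>[0, \<pi>/2]\<close>.
\<close>

lemma sin_pi_ge_linear:
  fixes x :: real
  assumes "0 \<le> x" "x \<le> 1 / 2"
  shows "2 * x \<le> sin (pi * x)"
proof -
  have "convex_on {0..pi / 2} (\<lambda>x. - sin x)"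
  proof (rule f''_ge0_imp_convex)
    show "((\<lambda>x. - sin x) has_real_derivative - cos x) (at x)" for x
      by (auto intro!: derivative_eq_intros)
    show "((\<lambda>x. - cos x) has_real_derivative sin x) (at x)" for x
      by (auto intro!: derivative_eq_intros)
    show "sin x \<ge> 0" if "x \<in> {0..pi / 2}" for x
      using that by (intro sin_ge_zero) auto
  qed simp
  then have "- sin ((1 - 2 * x) *\<^sub>R 0 + (2 * x) *\<^sub>R (pi / 2)) \<le>
      (1 - 2 * x) * - sin 0 + (2 * x) * - sin (pi / 2)"
    using assms by (intro convex_onD) auto
  then show ?thesis by (simp add: mult.commute)
qed

text \<open>
  Modulo \<open>\<pi>\<close> the argument is \<open>\<pi> r/n\<close> with \<open>r = d j mod n\<close>, and \<open>0 < r < n\<close> because \<open>d\<close> is invertible modulo \<open>n\<close>.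
\<close>

lemma sin_at_sample_lower_bound:
  fixes n d j :: nat
  assumes "coprime d n" "\<not> n dvd j" "n > 0"
  shows "\<bar>sin (pi * real d * (real j / real n))\<bar> \<ge> 2 / real n"
proof -
  define r where "r = (d * j) mod n"
  have "\<not> n dvd d * j" using assms by (simp add: coprime_dvd_mult_right_iff coprime_commute)
  then have r: "0 < r" "r < n" using \<open>n > 0\<close> by (auto simp: r_def dvd_eq_mod_eq_0)
  define x where "x = real r / real n"
  have x: "1 / real n \<le> x" "x \<le> 1 - 1 / real n" "0 < x" "x < 1"
    using r by (auto simp: x_def field_simps)
  have "2 / real n \<le> sin (pi * x)"
  proof (cases "x \<le> 1 / 2")
    case True
    then show ?thesis using sin_pi_ge_linear[of x] x by (auto simp: field_simps)
  next
    case False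
    have "sin (pi * x) = sin (pi * (1 - x))" by (simp add: algebra_simps sin_diff)
    then show ?thesis using sin_pi_ge_linear[of "1 - x"] x False by (auto simp: field_simps)
  qed
  also have "\<dots> = \<bar>sin (pi * x)\<bar>"
    using x by (simp add: sin_ge_zero)
  also have "\<dots> = \<bar>sin (pi * real d * (real j / real n))\<bar>"
  proof -
    have "real (d * j) = real (n * (d * j div n) + r)" by (simp only: r_def mult_div_mod_eq)
    then have "real d * (real j / real n) = x + real (d * j div n)"
      using \<open>n > 0\<close> by (simp add: x_def field_simps)
    then have "pi * (real d * (real j / real n)) = pi * (x + real (d * j div n))"
      by (simp only:)
    then have "sin (pi * real d * (real j / real n)) = sin (pi * x + real (d * j div n) * pi)"
      by (simp only: mult.assoc distrib_left mult.commute[of pi "real (d * j div n)"])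
    also have "\<dots> = sin (pi * x) * cos (real (d * j div n) * pi)"
      by (simp add: sin_add)
    finally show ?thesis by (simp add: abs_mult cos_npi mult.commute[of _ pi])
  qed
  finally show ?thesis .
qed

section \<open>Integrability of log-sine and step functions\<close>

lemma set_integrable_affine:
  fixes f :: "real \<Rightarrow> real"
  assumes "set_integrable lborel A f" "c \<noteq> 0"
  shows "set_integrable lborel {x. b + c * x \<in> A} (\<lambda>x. f (b + c * x))"
  using lborel_integrable_real_affine[of "\<lambda>x. indicator A x *\<^sub>R f x" c b] assms
  by (simp add: set_integrable_def indicator_def)

text \<open>
  Near 0 the logarithm is dominated by the integrable function \<open>x powr (- 1 / 2)\<close>.
\<close>

lemma ln_abs_sin_pi_integrable_half: "set_integrable lborel {0..1/2} (\<lambda>x::real. ln \<bar>sin (pi * x)\<bar>)"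
proof -
  have "(\<lambda>x::real. x powr (- 1 / 2)) absolutely_integrable_on {0..1/2}"
    using has_integral_powr_from_0[of "- 1 / 2" "1 / 2"]
    by (intro nonnegative_absolutely_integrable_1) (auto simp: integrable_on_def)
  then have *: "set_integrable lborel {0..1/2} (\<lambda>x::real. x powr (- 1 / 2))"
    unfolding set_integrable_def
    by (subst (asm) integrable_completion) (auto intro!: borel_measurable_indicator borel_measurable_times)
  have bound: "\<bar>ln \<bar>sin (pi * x)\<bar>\<bar> \<le> 2 * x powr (- 1 / 2)" if "0 \<le> x" "x \<le> 1 / 2" for x :: real
  proof (cases "x = 0")
    case False
    then have x: "x > 0" using that by simp
    have s: "x \<le> sin (pi * x)" "sin (pi * x) \<le> 1"
      using sin_pi_ge_linear[OF that] x by (linarith, simp)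
    have "\<bar>ln \<bar>sin (pi * x)\<bar>\<bar> = - ln (sin (pi * x))"
      using s x by simp
    also have "\<dots> \<le> - ln x"
      using s x by simp
    also have "\<dots> = 2 * ln (x powr (- 1 / 2))"
      using x by (simp add: ln_powr)
    also have "\<dots> \<le> 2 * x powr (- 1 / 2)"
      using ln_le_minus_one[of "x powr (- 1 / 2)"] x by simp
    finally show ?thesis .
  qed simp
  have "set_integrable lborel {0..1/2} (\<lambda>x::real. 2 * x powr (- 1 / 2))"
    using * by simp
  then show ?thesis
    unfolding set_integrable_def
  proof (rule Bochner_Integration.integrable_bound)
    show "AE x in lborel. norm (indicator {0..1/2} x *\<^sub>R ln \<bar>sin (pi * x)\<bar>) \<le>
        norm (indicator {0..1/2} x *\<^sub>R (2 * x powr (- 1 / 2)))"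
    proof (rule AE_I2)
      fix x :: real
      show "norm (indicator {0..1/2} x *\<^sub>R ln \<bar>sin (pi * x)\<bar>) \<le>
          norm (indicator {0..1/2} x *\<^sub>R (2 * x powr (- 1 / 2)))"
        using bound[of x] by (cases "x \<in> {0..1/2}") auto
    qed
  qed measurable
qed

text \<open>
  The case \<open>d = 1\<close> on \<open>[0, 1/2]\<close> extends to \<open>[0, 1]\<close> by reflection, to \<open>[0, d]\<close> by periodicity, and
  returns to \<open>[0, 1]\<close> by scaling.
\<close>

lemma ln_abs_sin_integrable:
  assumes "d > 0"
  shows "set_integrable lborel {0..1} (\<lambda>x. ln \<bar>sin (pi * real d * x)\<bar>)"
proof -
  let ?h = "\<lambda>x::real. ln \<bar>sin (pi * x)\<bar>"
  have refl: "?h (1 + (- 1) * x) = ?h x" for x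
    by (simp add: algebra_simps sin_diff)
  have "set_integrable lborel {x. 1 + (- 1) * x \<in> {0..1/2}} (\<lambda>x. ?h (1 + (- 1) * x))"
    by (rule set_integrable_affine[OF ln_abs_sin_pi_integrable_half]) simp
  moreover have "{x. 1 + (- 1) * x \<in> {0..1/2}} = {1/2..1::real}" by auto
  ultimately have "set_integrable lborel {1/2..1} ?h" by (simp only: refl)
  then have "set_integrable lborel ({0..1/2} \<union> {1/2..1}) ?h"
    using ln_abs_sin_pi_integrable_half by (intro set_integrable_Un) auto
  moreover have "{0..1/2} \<union> {1/2..1} = {0..1::real}" by auto
  ultimately have unit: "set_integrable lborel {0..1} ?h" by simp
  have shift: "?h (- real m + 1 * x) = ?h x" for m x
  proof -
    have "pi * (- real m + 1 * x) = pi * x - pi * real m" by (simp add: right_diff_distrib)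
    then have "sin (pi * (- real m + 1 * x)) = sin (pi * x) * (- 1) ^ m"
      by (simp only: sin_diff sin_npi2 cos_npi2 mult_zero_right diff_zero)
    then show ?thesis by (simp add: abs_mult)
  qed
  have "set_integrable lborel {0..real m} ?h" for m
  proof (induction m)
    case 0
    show ?case by (rule set_integrable_subset[OF unit]) auto
  next
    case (Suc m)
    have "set_integrable lborel {x. - real m + 1 * x \<in> {0..1}} (\<lambda>x. ?h (- real m + 1 * x))"
      by (rule set_integrable_affine[OF unit]) simp
    moreover have "{x. - real m + 1 * x \<in> {0..1}} = {real m..real (Suc m)}" by auto
    ultimately have "set_integrable lborel {real m..real (Suc m)} ?h" by (simp only: shift)
    then have "set_integrable lborel ({0..real m} \<union> {real m..real (Suc m)}) ?h"
      using Suc by (intro set_integrable_Un) auto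
    moreover have "{0..real m} \<union> {real m..real (Suc m)} = {0..real (Suc m)}" by auto
    ultimately show ?case by simp
  qed
  then have "set_integrable lborel {x. 0 + real d * x \<in> {0..real d}} (\<lambda>x. ?h (0 + real d * x))"
    using assms by (intro set_integrable_affine) auto
  moreover have "{x. 0 + real d * x \<in> {0..real d}} = {0..1}"
    using assms by (auto simp: zero_le_mult_iff mult_le_cancel_left1)
  ultimately show ?thesis by (simp add: mult.assoc)
qed

text \<open>
  The left-endpoint step function on \<open>[0, 1)\<close> with mesh \<open>1/n\<close>; its integral is the Riemann sum.
\<close>

definition sample_step :: "(real \<Rightarrow> real) \<Rightarrow> nat \<Rightarrow> real \<Rightarrow> real" where
  "sample_step f n t = (\<Sum>m<n. indicator {real m / real n..<real (Suc m) / real n} t * f (real m / real n))"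

lemma sample_step_measurable [measurable]: "sample_step f n \<in> borel_measurable borel"
  unfolding sample_step_def by measurable

lemma integral_sample_step:
  assumes "n > 0"
  shows "integral\<^sup>L lborel (sample_step f n) = (\<Sum>m<n. f (real m / real n)) / real n"
proof -
  have "integral\<^sup>L lborel (sample_step f n) =
      (\<Sum>m<n. integral\<^sup>L lborel (\<lambda>t. indicator {real m / real n..<real (Suc m) / real n} t * f (real m / real n)))"
    unfolding sample_step_def
    by (intro Bochner_Integration.integral_sum integrable_mult_left integrable_real_indicator)
       (simp_all add: emeasure_lborel_Ico divide_right_mono)
  also have "\<dots> = (\<Sum>m<n. f (real m / real n) / real n)"
    using assms by (intro sum.cong refl) (simp add: divide_simps)
  finally show ?thesis by (simp add: sum_divide_distrib)
qed

lemma sample_step_eq: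
  assumes "0 \<le> t" "t < 1" "n > 0"
  obtains m where "m < n" "real m / real n \<le> t" "t < real (Suc m) / real n"
    "sample_step f n t = f (real m / real n)"
proof -
  define m where "m = nat \<lfloor>t * real n\<rfloor>"
  have t: "0 \<le> t * real n" "t * real n < real n" using assms by auto
  have m: "real m \<le> t * real n" "t * real n < real (Suc m)"
    using t unfolding m_def by linarith+
  then have "m < n" using t by linarith
  have mem: "t \<in> {real l / real n..<real (Suc l) / real n} \<longleftrightarrow> l = m" for l
  proof -
    have "t \<in> {real l / real n..<real (Suc l) / real n} \<longleftrightarrow> real l \<le> t * real n \<and> t * real n < real (Suc l)"
      using assms(3) by (simp add: field_simps)
    also have "\<dots> \<longleftrightarrow> l = m" using m by auto
    finally show ?thesis .
  qed
  have "sample_step f n t = (\<Sum>l<n. if l = m then f (real m / real n) else 0)"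
    unfolding sample_step_def
  proof (rule sum.cong[OF refl])
    fix l
    show "indicator {real l / real n..<real (Suc l) / real n} t * f (real l / real n) =
        (if l = m then f (real m / real n) else 0)"
      unfolding indicator_def mem[of l] by simp
  qed
  also have "\<dots> = f (real m / real n)" using \<open>m < n\<close> by simp
  finally show ?thesis
    using that[of m] \<open>m < n\<close> mem[of m] by simp
qed

lemma sample_step_outside:
  assumes "t \<notin> {0..<1}"
  shows "sample_step f n t = 0"
  unfolding sample_step_def
proof (rule sum.neutral, rule ballI)
  fix m assume "m \<in> {..<n}"
  then have "real (Suc m) / real n \<le> 1"
    by (simp add: divide_le_eq_1)
  moreover have "0 \<le> real m / real n" by simp
  ultimately have "t \<notin> {real m / real n..<real (Suc m) / real n}"
    using assms unfolding atLeastLessThan_iff by linarith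
  then show "indicator {real m / real n..<real (Suc m) / real n} t * f (real m / real n) = 0"
    unfolding indicator_def by simp
qed

section \<open>Riemann sums of the logarithm\<close>

lemma AE_sin_nonzero:
  assumes "d > 0"
  shows "AE t in lborel. sin (pi * real d * t) \<noteq> 0"
proof -
  have "{t. sin (pi * real d * t) = 0} \<subseteq> range (\<lambda>i::int. of_int i / real d)"
  proof
    fix t assume "t \<in> {t. sin (pi * real d * t) = 0}"
    then obtain i :: int where "pi * real d * t = of_int i * pi"
      by (auto simp: sin_zero_iff_int2)
    then have "t = of_int i / real d" using assms by (simp add: field_simps)
    then show "t \<in> range (\<lambda>i::int. of_int i / real d)" by blast
  qed
  then have "countable {t. sin (pi * real d * t) = 0}"
    by (rule countable_subset) simp
  then have "{t. sin (pi * real d * t) = 0} \<in> null_sets lborel"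
    by (rule countable_imp_null_set_lborel)
  from AE_not_in[OF this] show ?thesis by simp
qed

lemma sine_symbol_measurable [measurable]: "sine_symbol S \<in> borel_measurable borel"
  unfolding sine_symbol_def by measurable

lemma isCont_sine_symbol: "isCont (sine_symbol S) t"
  unfolding sine_symbol_def by (intro continuous_intros)

text \<open>
  The domination: within the mesh cell to the right of a sample point \<open>u = m/n\<close>, the function
  \<open>|sin(\<pi> d t)|\<close> exceeds \<open>|sin(\<pi> d u)|\<close> by at most \<open>\<pi> d/n\<close>, and \<open>1/n \<le> |sin(\<pi> d u)| / 2\<close> unless \<open>u = 0\<close>. So the two values
  are comparable up to the factor \<open>K\<close>, independently of \<open>n\<close>.
\<close>

lemma ln_sine_symbol_sample_bound:
  assumes "finite S" "S \<noteq> {}" "0 \<notin> S"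
  shows "\<exists>B\<ge>0.
    (\<forall>n m t. n > 0 \<longrightarrow> coprime (Gcd S) n \<longrightarrow> m < n \<longrightarrow>
      real m / real n \<le> t \<longrightarrow> t < real (Suc m) / real n \<longrightarrow>
      sin (pi * real (Gcd S) * t) \<noteq> 0 \<longrightarrow>
      \<bar>ln (sine_symbol S (real m / real n))\<bar> \<le> B - 2 * ln \<bar>sin (pi * real (Gcd S) * t)\<bar>) \<and>
    (\<forall>t. sin (pi * real (Gcd S) * t) \<noteq> 0 \<longrightarrow>
      \<bar>ln (sine_symbol S t)\<bar> \<le> B - 2 * ln \<bar>sin (pi * real (Gcd S) * t)\<bar>)"
proof -
  let ?s = "\<lambda>t. \<bar>sin (pi * real (Gcd S) * t)\<bar>"
  obtain c where c: "c > 0" "\<And>t. c * (sin (pi * real (Gcd S) * t))\<^sup>2 \<le> sine_symbol S t"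
    using sine_symbol_lower_bound[OF assms(1,2)] by auto
  have card: "card S > 0" using assms by (simp add: card_gt_0_iff)
  \<comment> \<open>A bound for the sine at a point of a mesh cell over the sine at its left end, up to sign.\<close>
  define K where "K = 1 + pi * real (Gcd S) / 2"
  have K: "K \<ge> 1" by (simp add: K_def)
  define B where "B = \<bar>ln c\<bar> + \<bar>ln (4 * real (card S))\<bar> + 2 * ln K"
  have general: "\<bar>ln (sine_symbol S u)\<bar> \<le> B - 2 * ln (?s t)" if "?s t > 0" "?s t \<le> K * ?s u" for u t
  proof -
    have "?s u > 0" using that by (cases "?s u = 0") simp_all
    have W: "c * (?s u)\<^sup>2 \<le> sine_symbol S u" "sine_symbol S u \<le> 4 * real (card S)"
      using c(2)[of u] sine_symbol_upper_bound by simp_all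
    have "c * (?s u)\<^sup>2 > 0" using c(1) \<open>?s u > 0\<close> by simp
    then have pos: "sine_symbol S u > 0" using W(1) by linarith
    have "ln (?s t) \<le> ln (K * ?s u)" using that by simp
    also have "\<dots> = ln K + ln (?s u)" using K \<open>?s u > 0\<close> by (simp add: ln_mult)
    finally have st: "ln (?s t) \<le> ln K + ln (?s u)" .
    have "ln c + 2 * ln (?s u) = ln (c * (?s u)\<^sup>2)"
      using c(1) \<open>?s u > 0\<close> by (subst ln_mult_pos) (simp_all only: ln_realpow zero_less_power of_nat_numeral)
    also have "\<dots> \<le> ln (sine_symbol S u)" using W(1) \<open>c * (?s u)\<^sup>2 > 0\<close> by simp
    finally have low: "ln c + 2 * ln (?s u) \<le> ln (sine_symbol S u)" .
    have up: "ln (sine_symbol S u) \<le> ln (4 * real (card S))" using W(2) pos by simp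
    have "ln (?s t) \<le> 0" using that(1) by simp
    moreover have "ln K \<ge> 0" using K by simp
    ultimately show ?thesis using st low up unfolding B_def by linarith
  qed
  have B: "B \<ge> 0" using K by (simp add: B_def)
  show ?thesis
  proof (intro exI[of _ B] conjI allI impI)
    fix t assume "sin (pi * real (Gcd S) * t) \<noteq> 0"
    then show "\<bar>ln (sine_symbol S t)\<bar> \<le> B - 2 * ln (?s t)"
      using K by (intro general) (auto simp: mult_le_cancel_right1)
  next
    fix n m :: nat and t :: real
    assume n: "n > 0" "coprime (Gcd S) n" and m: "m < n" "real m / real n \<le> t" "t < real (Suc m) / real n"
      and nz: "sin (pi * real (Gcd S) * t) \<noteq> 0"
    show "\<bar>ln (sine_symbol S (real m / real n))\<bar> \<le> B - 2 * ln (?s t)"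
    \<comment> \<open>At the sample point 0 the symbol vanishes, and \<open>ln 0 = 0\<close> satisfies any nonnegative bound.\<close>
    proof (cases "m = 0")
      case True
      have "ln (?s t) \<le> 0" using nz by simp
      then show ?thesis using B True by (simp add: sine_symbol_def)
    next
      case False
      let ?u = "real m / real n"
      have u: "?s ?u \<ge> 2 / real n"
      proof (rule sin_at_sample_lower_bound[OF n(2) _ n(1)])
        show "\<not> n dvd m" using False m(1) by (auto dest: dvd_imp_le)
      qed
      have "real (Suc m) / real n = ?u + 1 / real n" by (simp add: add_divide_distrib)
      then have "\<bar>t - ?u\<bar> \<le> 1 / real n" using m(2,3) by linarith
      let ?\<delta> = "pi * real (Gcd S) * (?u - t)"
      have "?s t = \<bar>sin (pi * real (Gcd S) * ?u - ?\<delta>)\<bar>" by (simp add: right_diff_distrib)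
      also have "\<dots> \<le> ?s ?u + \<bar>sin ?\<delta>\<bar>" by (rule abs_sin_diff_le)
      also have "\<bar>sin ?\<delta>\<bar> \<le> \<bar>?\<delta>\<bar>" by (rule abs_sin_x_le_abs_x)
      also have "\<dots> = pi * real (Gcd S) * \<bar>t - ?u\<bar>"
        by (simp add: abs_mult abs_minus_commute)
      also have "\<dots> \<le> pi * real (Gcd S) * (1 / real n)"
        using \<open>\<bar>t - ?u\<bar> \<le> 1 / real n\<close> by (intro mult_left_mono) auto
      also have "\<dots> \<le> pi * real (Gcd S) * (?s ?u / 2)"
        using u by (intro mult_left_mono) auto
      finally have "?s t \<le> K * ?s ?u" by (simp add: K_def algebra_simps)
      then show ?thesis using nz by (intro general) auto
    qed
  qed (rule B)
qed

lemma sample_step_tendsto: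
  fixes t :: real
  assumes "0 \<le> t" "t < 1" "isCont f t"
  shows "(\<lambda>n. sample_step f n t) \<longlonglongrightarrow> f t"
proof -
  have "\<forall>n. \<exists>x. n > 0 \<longrightarrow> \<bar>x - t\<bar> \<le> 1 / real n \<and> sample_step f n t = f x"
  proof
    fix n
    show "\<exists>x. n > 0 \<longrightarrow> \<bar>x - t\<bar> \<le> 1 / real n \<and> sample_step f n t = f x"
    proof (cases "n > 0")
      case True
      from sample_step_eq[OF assms(1,2) True, of f] obtain m where
        m: "m < n" "real m / real n \<le> t" "t < real (Suc m) / real n" "sample_step f n t = f (real m / real n)" .
      have "real (Suc m) / real n = real m / real n + 1 / real n" by (simp add: add_divide_distrib)
      then have "\<bar>real m / real n - t\<bar> \<le> 1 / real n" using m(2,3) by linarith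
      then show ?thesis using m(4) by blast
    qed simp
  qed
  from choice[OF this] obtain x where
    x: "\<And>n. n > 0 \<Longrightarrow> \<bar>x n - t\<bar> \<le> 1 / real n" "\<And>n. n > 0 \<Longrightarrow> sample_step f n t = f (x n)" by blast
  have "(\<lambda>n. x n - t) \<longlonglongrightarrow> 0"
    by (rule tendsto_0_le[OF lim_inverse_n', where K = 1])
       (auto simp: eventually_sequentially x intro!: exI[of _ 1])
  then have "x \<longlonglongrightarrow> t" by (rule LIM_zero_cancel)
  then have "(\<lambda>n. f (x n)) \<longlonglongrightarrow> f t" by (rule isCont_tendsto_compose[OF assms(3)])
  moreover have "\<forall>\<^sub>F n in sequentially. f (x n) = sample_step f n t"
    using eventually_gt_at_top[of 0] by eventually_elim (simp add: x)
  ultimately show ?thesis by (rule Lim_transform_eventually)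
qed

text \<open>
  Dominated convergence for the step functions. Where the gcd of the jumps shares a factor with \<open>n\<close>, a sample
  point may hit a singularity; the filter excludes these \<open>n\<close>.
\<close>

theorem riemann_sum_ln_sine_symbol:
  assumes "finite S" "S \<noteq> {}" "0 \<notin> S"
  shows "((\<lambda>n. (\<Sum>m<n. ln (sine_symbol S (real m / real n))) / real n) \<longlongrightarrow>
    (LBINT t:{0..1}. ln (sine_symbol S t)))
    (inf sequentially (principal {n. coprime (Gcd S) n}))"
proof -
  define f where "f = (\<lambda>t. ln (sine_symbol S t))"
  have f_eq: "f t = ln (sine_symbol S t)" for t by (simp add: f_def)
  define g where "g = (\<lambda>t. indicator {0..1} t * f t)"
  define G where "G = {n. n > 0 \<and> coprime (Gcd S) n}"
  \<comment> \<open>Replacing the excluded step functions by their limit makes this an ordinary sequence.\<close>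
  define X where "X = (\<lambda>n. if n \<in> G then sample_step f n else g)"
  have d: "Gcd S > 0"
  proof (rule ccontr)
    assume "\<not> Gcd S > 0"
    then have "S \<subseteq> {0}" using Gcd_0_iff[of S] by simp
    then show False using assms(2,3) by blast
  qed
  obtain B where B: "B \<ge> 0"
    "\<And>n m t. n > 0 \<Longrightarrow> coprime (Gcd S) n \<Longrightarrow> m < n \<Longrightarrow> real m / real n \<le> t \<Longrightarrow> t < real (Suc m) / real n \<Longrightarrow>
      sin (pi * real (Gcd S) * t) \<noteq> 0 \<Longrightarrow>
      \<bar>f (real m / real n)\<bar> \<le> B - 2 * ln \<bar>sin (pi * real (Gcd S) * t)\<bar>"
    "\<And>t. sin (pi * real (Gcd S) * t) \<noteq> 0 \<Longrightarrow>
      \<bar>f t\<bar> \<le> B - 2 * ln \<bar>sin (pi * real (Gcd S) * t)\<bar>"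
    using ln_sine_symbol_sample_bound[OF assms, folded f_eq]
    by (elim exE conjE) (rule that, assumption, blast, blast)
  obtain c where c: "c > 0" "\<And>t. c * (sin (pi * real (Gcd S) * t))\<^sup>2 \<le> sine_symbol S t"
    using sine_symbol_lower_bound[OF assms(1,2)] by auto
  define w where "w = (\<lambda>t. indicator {0..1} t *\<^sub>R (B - 2 * ln \<bar>sin (pi * real (Gcd S) * t)\<bar>))"
  have f_meas [measurable]: "f \<in> borel_measurable borel" unfolding f_def by measurable
  have AE: "AE t in lborel. sin (pi * real (Gcd S) * t) \<noteq> 0 \<and> t \<noteq> 1"
    using AE_sin_nonzero[OF d] AE_lborel_singleton[of 1] by eventually_elim auto
  have "(\<lambda>n. integral\<^sup>L lborel (X n)) \<longlonglongrightarrow> integral\<^sup>L lborel g"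
  proof (rule integral_dominated_convergence)
    show "g \<in> borel_measurable lborel" unfolding g_def by measurable
    show "X n \<in> borel_measurable lborel" for n
    proof (cases "n \<in> G")
      case False
      then show ?thesis using \<open>g \<in> borel_measurable lborel\<close> by (simp add: X_def)
    qed (simp add: X_def)
    have "set_integrable lborel {0..1} (\<lambda>t. B - 2 * ln \<bar>sin (pi * real (Gcd S) * t)\<bar>)"
    proof (rule set_integral_diff(1))
      show "set_integrable lborel {0..1} (\<lambda>t::real. B)"
        by (rule borel_integrable_atLeastAtMost') simp
    qed (use ln_abs_sin_integrable[OF d] in simp)
    then show "integrable lborel w" by (simp add: w_def set_integrable_def)
    show "AE t in lborel. (\<lambda>n. X n t) \<longlonglongrightarrow> g t"
      using AE
    proof eventually_elim
      case (elim t)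
      show ?case
      proof (cases "t \<in> {0..<1}")
        case False
        then have "g t = 0" using elim by (auto simp: g_def indicator_def)
        then have "X n t = g t" for n using sample_step_outside[OF False] by (simp add: X_def)
        then show ?thesis by simp
      next
        case True
        have "sine_symbol S t > 0"
        proof -
          have "0 < c * (sin (pi * real (Gcd S) * t))\<^sup>2" using c(1) elim by simp
          also have "\<dots> \<le> sine_symbol S t" by (rule c(2))
          finally show ?thesis .
        qed
        then have "isCont f t"
          unfolding f_def by (intro continuous_intros isCont_sine_symbol) auto
        then have "(\<lambda>n. sample_step f n t) \<longlonglongrightarrow> g t"
          using sample_step_tendsto[of t f] True by (simp add: g_def)
        then have "(\<lambda>n. X n t - g t) \<longlonglongrightarrow> 0"
          by (intro tendsto_0_le[where K = 1, OF LIM_zero]) (auto simp: X_def)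
        then show ?thesis by (rule LIM_zero_cancel)
      qed
    qed
    show "AE t in lborel. norm (X n t) \<le> w t" for n
      using AE
    proof eventually_elim
      case (elim t)
      have nonneg: "0 \<le> B - 2 * ln \<bar>sin (pi * real (Gcd S) * t)\<bar>"
        using B(3)[of t] elim order_trans[OF abs_ge_zero] by blast
      show ?case
      proof (cases "n \<in> G \<and> t \<in> {0..<1}")
        case True
        then have n: "n > 0" "coprime (Gcd S) n" by (auto simp: G_def)
        obtain m where m: "m < n" "real m / real n \<le> t" "t < real (Suc m) / real n"
          "sample_step f n t = f (real m / real n)"
          using sample_step_eq[of t n f] True n by auto
        have "norm (X n t) = \<bar>f (real m / real n)\<bar>" using True m by (simp add: X_def)
        also have "\<dots> \<le> w t" using B(2)[OF n m(1-3)] elim True by (simp add: w_def)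
        finally show ?thesis .
      next
        case False
        then have "X n t = 0 \<or> t \<in> {0..1} \<and> X n t = f t"
          using sample_step_outside[of t f n] by (auto simp: X_def g_def indicator_def)
        then show ?thesis using B(3)[of t] elim nonneg by (auto simp: w_def indicator_def)
      qed
    qed
  qed
  moreover have "integral\<^sup>L lborel g = (LBINT t:{0..1}. ln (sine_symbol S t))"
    by (simp add: g_def f_def set_lebesgue_integral_def)
  ultimately have "((\<lambda>n. integral\<^sup>L lborel (X n)) \<longlongrightarrow> (LBINT t:{0..1}. ln (sine_symbol S t)))
      (inf sequentially (principal {n. coprime (Gcd S) n}))"
    by (auto intro: tendsto_mono[rotated])
  moreover have "\<forall>\<^sub>F n in inf sequentially (principal {n. coprime (Gcd S) n}).
      integral\<^sup>L lborel (X n) = (\<Sum>m<n. f (real m / real n)) / real n"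
    unfolding eventually_inf_principal using eventually_gt_at_top[of 0]
    by eventually_elim (auto simp: X_def G_def integral_sample_step)
  ultimately show ?thesis
    unfolding f_def by (rule Lim_transform_eventually)
qed

section \<open>Connectivity and the thermodynamic limit\<close>

lemma circulant_translate_edge:
  assumes "i < n" "a \<in> S"
  shows "{i, nat ((int i + int a) mod int n)} \<in> edges (circulant n S)"
    and "{i, nat ((int i - int a) mod int n)} \<in> edges (circulant n S)"
proof -
  have "{i, nat (x mod int n)} \<in> edges (circulant n S)"
    if x: "x = int i + int a \<or> x = int i - int a" for x
  proof -
    let ?j = "nat (x mod int n)"
    have "?j < n" "[int ?j = x] (mod int n)"
      using assms(1) by (simp_all add: nat_less_iff)
    then show ?thesis
      using x assms unfolding circulant_def sgraph.select_convs by blast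
  qed
  then show "{i, nat ((int i + int a) mod int n)} \<in> edges (circulant n S)"
    and "{i, nat ((int i - int a) mod int n)} \<in> edges (circulant n S)"
    by blast+
qed

text \<open>
  Every edge changes the vertex by a multiple of the gcd modulo \<open>n\<close>, so residues modulo the gcd are constant
  on components. Conversely, the integers by which every vertex can be translated along a walk, in both
  directions, are closed under subtraction and contain \<open>n\<close> and the jumps, hence 1.
\<close>

lemma circulant_connected_iff:
  assumes "n > 1" "finite S"
  shows "connected_graph (circulant n S) \<longleftrightarrow> Gcd (insert n S) = 1"
proof
  let ?g = "Gcd (insert n S)"
  assume conn: "connected_graph (circulant n S)"
  have "(0, 1) \<in> (adj_rel (edges (circulant n S)))\<^sup>*"
    using conn \<open>n > 1\<close> by (simp add: connected_graph_def circulant_def)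
  moreover have "[int 0 = int v] (mod int ?g)" if "(0, v) \<in> (adj_rel (edges (circulant n S)))\<^sup>*" for v
    using that
  proof (induction rule: rtrancl_induct)
    case base
    show ?case by simp
  next
    case (step u v)
    have g_n: "int ?g dvd int n" and g_S: "\<And>a. a \<in> S \<Longrightarrow> int ?g dvd int a"
      unfolding int_dvd_int_iff by (rule Gcd_dvd; simp)+
    from step(2) obtain i j a where ij: "{u, v} = {i, j}" "a \<in> S"
      "[int j = int i + int a] (mod int n) \<or> [int j = int i - int a] (mod int n)"
      by (auto simp: circulant_def)
    have "int ?g dvd int j - int i"
    proof -
      have "int ?g dvd int j - (int i + int a) \<or> int ?g dvd int j - (int i - int a)"
        using ij(3) g_n by (auto simp: cong_iff_dvd_diff dest: dvd_trans)
      then show ?thesis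
      proof
        assume "int ?g dvd int j - (int i + int a)"
        from dvd_add[OF this g_S[OF ij(2)]] show ?thesis by simp
      next
        assume "int ?g dvd int j - (int i - int a)"
        from dvd_diff[OF this g_S[OF ij(2)]] show ?thesis by simp
      qed
    qed
    then have "[int j = int i] (mod int ?g)" by (simp add: cong_iff_dvd_diff)
    then have "[int u = int v] (mod int ?g)"
      using ij(1) by (auto simp: doubleton_eq_iff cong_sym)
    with step(3) show ?case by (rule cong_trans)
  qed
  ultimately have "[int 0 = int 1] (mod int ?g)" by blast
  then have "int ?g dvd 1" by (simp add: cong_iff_dvd_diff)
  then show "?g = 1" by (metis int_dvd_int_iff nat_dvd_1_iff_1 of_nat_1)
next
  assume gcd: "Gcd (insert n S) = 1"
  let ?R = "(adj_rel (edges (circulant n S)))\<^sup>*"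
  define D where "D = {x :: int. \<forall>i<n. (i, nat ((int i + x) mod int n)) \<in> ?R \<and>
    (i, nat ((int i - x) mod int n)) \<in> ?R}"
  have move: "nat ((int (nat ((int i + x) mod int n)) + y) mod int n) = nat ((int i + (x + y)) mod int n)"
    for i x y
    using \<open>n > 1\<close> by (simp add: mod_add_left_eq add.assoc)
  have "int (Gcd (insert n S)) \<in> D"
  proof (rule int_Gcd_mem_if_diff_closed)
    fix a assume "a \<in> insert n S"
    then show "int a \<in> D"
    proof
      assume "a = n"
      then show ?thesis by (simp add: D_def)
    next
      assume "a \<in> S"
      then show ?thesis using circulant_translate_edge[of _ n a S] by (auto simp: D_def)
    qed
  next
    fix x y assume xy: "x \<in> D" "y \<in> D"
    have lt: "nat (z mod int n) < n" for z using \<open>n > 1\<close> by (simp add: nat_less_iff)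
    have plus: "(i, nat ((int i + x) mod int n)) \<in> ?R" "(i, nat ((int i + y) mod int n)) \<in> ?R"
      and minus: "(i, nat ((int i + - x) mod int n)) \<in> ?R" "(i, nat ((int i + - y) mod int n)) \<in> ?R"
      if "i < n" for i
      using xy that by (auto simp: D_def)
    have "(i, nat ((int i + (x - y)) mod int n)) \<in> ?R \<and> (i, nat ((int i - (x - y)) mod int n)) \<in> ?R"
      if "i < n" for i
    proof
      have "(i, nat ((int i + (x + - y)) mod int n)) \<in> ?R"
        using rtrancl_trans[OF plus(1)[OF that] minus(2)[OF lt]] by (simp only: move)
      then show "(i, nat ((int i + (x - y)) mod int n)) \<in> ?R" by simp
      have "(i, nat ((int i + (y + - x)) mod int n)) \<in> ?R"
        using rtrancl_trans[OF plus(2)[OF that] minus(1)[OF lt]] by (simp only: move)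
      then show "(i, nat ((int i - (x - y)) mod int n)) \<in> ?R" by (simp add: algebra_simps)
    qed
    then show "x - y \<in> D" by (simp add: D_def)
  qed (use \<open>finite S\<close> in auto)
  then have step: "(i, nat ((int i + 1) mod int n)) \<in> ?R" if "i < n" for i
    using gcd that by (simp add: D_def)
  have from0: "(0, v) \<in> ?R" if "v < n" for v
    using that
  proof (induction v)
    case (Suc v)
    then have "nat ((int v + 1) mod int n) = Suc v" by (simp add: nat_eq_iff)
    with step[of v] Suc show ?case by (auto intro: rtrancl_trans)
  qed simp
  have "sym ?R" by (intro sym_rtrancl) (auto simp: sym_def insert_commute)
  then have "(u, v) \<in> ?R" if "u < n" "v < n" for u v
    using from0[OF that(1)] from0[OF that(2)] by (meson rtrancl_trans symD)
  then show "connected_graph (circulant n S)"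
    using \<open>n > 1\<close> by (auto simp: connected_graph_def circulant_def)
qed

lemma cmod_circulant_laurent:
  assumes "inj_on s {1..k}"
  shows "cmod (circulant_laurent k s (exp (2 * complex_of_real pi * \<i> * complex_of_real t))) =
    sine_symbol (s ` {1..k}) t"
proof -
  let ?z = "cis (2 * pi * t)"
  have "exp (2 * complex_of_real pi * \<i> * complex_of_real t) = ?z"
    by (simp add: cis_conv_exp mult_ac)
  moreover have "circulant_laurent k s ?z =
      2 * of_nat (card (s ` {1..k})) - (\<Sum>a\<in>s ` {1..k}. ?z ^ a + inverse ?z ^ a)"
    using assms
    by (simp add: circulant_laurent_def card_image sum.reindex power_int_minus power_inverse del: cis_inverse)
  ultimately have "circulant_laurent k s (exp (2 * complex_of_real pi * \<i> * complex_of_real t)) =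
      complex_of_real (sine_symbol (s ` {1..k}) t)"
    by (simp only: sine_symbol_cis finite_imageI finite_atLeastAtMost)
  moreover have "sine_symbol (s ` {1..k}) t \<ge> 0"
    unfolding sine_symbol_def by (intro sum_nonneg) simp
  ultimately show ?thesis by simp
qed

lemma sine_symbol_sample_pos:
  assumes "finite S" "S \<noteq> {}" "coprime (Gcd S) n" "0 < m" "m < n"
  shows "sine_symbol S (real m / real n) > 0"
proof -
  obtain c where c: "c > 0" "\<And>t. c * (sin (pi * real (Gcd S) * t))\<^sup>2 \<le> sine_symbol S t"
    using sine_symbol_lower_bound[OF assms(1,2)] by auto
  have "\<not> n dvd m" using assms(4,5) by (auto dest: dvd_imp_le)
  then have "2 / real n \<le> \<bar>sin (pi * real (Gcd S) * (real m / real n))\<bar>"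
    using assms by (intro sin_at_sample_lower_bound) auto
  moreover have "2 / real n > 0" using assms by simp
  ultimately have "sin (pi * real (Gcd S) * (real m / real n)) \<noteq> 0" by linarith
  then have "0 < c * (sin (pi * real (Gcd S) * (real m / real n)))\<^sup>2" using c(1) by simp
  also have "\<dots> \<le> sine_symbol S (real m / real n)" by (rule c(2))
  finally show ?thesis .
qed

text \<open>
  The term for \<open>m = 0\<close> may be included in the sum since \<open>ln 0 = 0\<close>.
\<close>

lemma ln_num_spanning_trees_circulant:
  assumes "finite S" "S \<noteq> {}" "coprime (Gcd S) n" "n > 0"
    and S: "\<And>a. a \<in> S \<Longrightarrow> 0 < a \<and> 2 * a < n"
  shows "ln (real (num_spanning_trees (circulant n S))) =
    (\<Sum>m<n. ln (sine_symbol S (real m / real n))) - ln (real n)"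
proof -
  let ?T = "num_spanning_trees (circulant n S)"
  have formula: "real n * real ?T = (\<Prod>m = 1..<n. sine_symbol S (real m / real n))"
    using circulant_spanning_tree_formula[OF \<open>n > 0\<close> \<open>finite S\<close> S] by simp
  have pos: "sine_symbol S (real m / real n) > 0" if "m \<in> {1..<n}" for m
    using sine_symbol_sample_pos[OF assms(1-3), of m] that by simp
  have prod_pos: "(\<Prod>m = 1..<n. sine_symbol S (real m / real n)) > 0"
    by (intro prod_pos pos)
  then have "real ?T > 0" using formula \<open>n > 0\<close> by (metis zero_less_mult_pos of_nat_0_less_iff)
  then have "ln (real n) + ln (real ?T) = ln (real n * real ?T)"
    using \<open>n > 0\<close> by (subst ln_mult_pos) simp_all
  also have "\<dots> = (\<Sum>m = 1..<n. ln (sine_symbol S (real m / real n)))"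
    unfolding formula using pos by (intro ln_prod) (auto simp: less_imp_neq[symmetric])
  also have "\<dots> = (\<Sum>m<n. ln (sine_symbol S (real m / real n)))"
    using \<open>n > 0\<close> by (simp add: lessThan_atLeast0 sum.atLeast_Suc_lessThan sine_symbol_def)
  finally show ?thesis by simp
qed

theorem corollary3:
  fixes k :: nat and s :: "nat \<Rightarrow> nat"
  assumes "k \<ge> 1"
    and "1 \<le> s 1"
    and "strict_mono_on {1..k} s"
  shows "(\<forall>n>2 * s k. connected_graph (circulant n (s ` {1..k})) \<longleftrightarrow>
            Gcd (insert n (s ` {1..k})) = 1) \<and>
         has_thermodynamic_limit (\<lambda>n. circulant n (s ` {1..k}))
           (inf sequentially (principal {n. n > 2 * s k \<and> Gcd (insert n (s ` {1..k})) = 1}))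
           (small_mahler_measure (circulant_laurent k s))"
proof
  let ?S = "s ` {1..k}"
  have le: "s i \<le> s j" if "1 \<le> i" "i \<le> j" "j \<le> k" for i j
    using strict_mono_on_leD[OF assms(3), of i j] that by simp
  have S: "0 < a \<and> a \<le> s k" if "a \<in> ?S" for a
    using that le[of 1] le[of _ k] assms(2) by fastforce
  have fin: "finite ?S" "?S \<noteq> {}" using assms(1) by auto
  have "s k \<ge> 1" using S[of "s k"] assms(1) by auto
  then show "\<forall>n>2 * s k. connected_graph (circulant n ?S) \<longleftrightarrow> Gcd (insert n ?S) = 1"
    using circulant_connected_iff[OF _ fin(1)] by auto
  let ?I = "LBINT t:{0..1}. ln (sine_symbol ?S t)"
  let ?A = "{n. n > 2 * s k \<and> Gcd (insert n ?S) = 1}"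
  let ?F = "inf sequentially (principal ?A)"
  have "inj_on s {1..k}" using assms(3) by (rule strict_mono_on_imp_inj_on)
  then have mahler: "small_mahler_measure (circulant_laurent k s) = ?I"
    by (simp only: small_mahler_measure_def cmod_circulant_laurent)
  have coprime: "coprime (Gcd ?S) n" if "n \<in> ?A" for n
    using that by (simp add: coprime_iff_gcd_eq_1 gcd.commute)
  have "((\<lambda>n. (\<Sum>m<n. ln (sine_symbol ?S (real m / real n))) / real n) \<longlongrightarrow> ?I) ?F"
    using S by (intro tendsto_mono[OF _ riemann_sum_ln_sine_symbol] inf_mono)
       (use fin coprime in auto)
  moreover have "((\<lambda>n. ln (real n) / real n) \<longlongrightarrow> 0) ?F"
    by (rule tendsto_mono[OF inf_le1]) (rule lim_ln_over_n)
  ultimately have "((\<lambda>n. (\<Sum>m<n. ln (sine_symbol ?S (real m / real n))) / real n - ln (real n) / real n)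
      \<longlongrightarrow> ?I - 0) ?F"
    by (rule tendsto_diff)
  moreover have "\<forall>\<^sub>F n in ?F. (\<Sum>m<n. ln (sine_symbol ?S (real m / real n))) / real n - ln (real n) / real n =
      ln (real (num_spanning_trees (circulant n ?S))) / real (card (vertices (circulant n ?S)))"
    unfolding eventually_inf_principal
  proof (intro always_eventually allI impI)
    fix n assume n: "n \<in> ?A"
    have "0 < a \<and> 2 * a < n" if "a \<in> ?S" for a
      using S[OF that] n by auto
    then have "ln (real (num_spanning_trees (circulant n ?S))) =
        (\<Sum>m<n. ln (sine_symbol ?S (real m / real n))) - ln (real n)"
      using n by (intro ln_num_spanning_trees_circulant fin coprime) auto
    then show "(\<Sum>m<n. ln (sine_symbol ?S (real m / real n))) / real n - ln (real n) / real n =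
        ln (real (num_spanning_trees (circulant n ?S))) / real (card (vertices (circulant n ?S)))"
      by (simp add: circulant_def diff_divide_distrib)
  qed
  ultimately show "has_thermodynamic_limit (\<lambda>n. circulant n ?S) ?F
      (small_mahler_measure (circulant_laurent k s))"
    unfolding has_thermodynamic_limit_def mahler by (simp add: Lim_transform_eventually)
qed

end
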